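(* Let $r\ge 2$ and $n\ge 1$ be integers, $M=rn$, and let $\Bbbk$ be a field of characteristic different from $2$ containing a primitive $M$-th root of unity $q$. The Radford Hopf algebra $H_{(r,n,q)}$ has no non-zero infinitesimal $\mathcal{R}$-matrices: for every quasitriangular structure $\mathcal{R}$ on $H_{(r,n,q)}$ (if any exists), if $\chi$ is an infinitesimal $\mathcal{R}$-matrix for $(H_{(r,n,q)},\mathcal{R})$, then $\chi=0$.
   Context: $H_{(r,n,q)}$ is the Hopf algebra over $\Bbbk$ generated as an algebra by $g,x$ with relations $g^M=1$, $x^n=0$, $xg=qgx$, with $\Delta(g)=g\otimes g$, $\Delta(x)=1\otimes x+x\otimes g^r$, $\varepsilon(g)=1$, $\varepsilon(x)=0$, $S(g)=g^{M-1}$, $S(x)=-xg^{M-r}$. It has dimension $rn^2$ with basis $\{g^lx^m : 0\le l<M,\ 0\le m<n\}$. For a bialgebra $H$ and $T=\sum_i T^i\otimes T_i\in H\otimes H$ write $T_{12}=T\otimes 1$, $T_{23}=1\otimes T$, $T_{13}=\sum_i T^i\otimes 1\otimes T_i$. A quasitriangular structure on $H$ is an invertible $\mathcal{R}\in H\otimes H$ with $\Delta^{\mathrm{op}}(h)=\mathcal{R}\Delta(h)\mathcal{R}^{-1}$ for all $h$, $(\mathrm{Id}\otimes\Delta)(\mathcal{R})=\mathcal{R}_{13}\mathcal{R}_{12}$, $(\Delta\otimes\mathrm{Id})(\mathcal{R})=\mathcal{R}_{13}\mathcal{R}_{23}$. An infinitesimal $\mathcal{R}$-matrix for $(H,\mathcal{R})$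 is $\chi\in H\otimes H$ such that $\chi\Delta(h)=\Delta(h)\chi$ for all $h\in H$, $(\mathrm{Id}\otimes\Delta)(\chi)=\chi_{12}+\mathcal{R}_{12}^{-1}\chi_{13}\mathcal{R}_{12}$, and $(\Delta\otimes\mathrm{Id})(\chi)=\chi_{23}+\mathcal{R}_{23}^{-1}\chi_{13}\mathcal{R}_{23}$. *)

theory Defs
  imports "HOL-Computational_Algebra.Field_as_Ring" "HOL-Library.Poly_Mapping"
    "HOL-Algebra.QuotRing" "HOL-Algebra.Module"
begin

section \<open>Algebras over a field\<close>

text \<open>
  The ground field is a type of class \<^class>\<open>field\<close>.  An algebra over it is a record of type
  \<^typ>\<open>('k, 'a) module\<close>: a (not necessarily commutative) ring record together with a scalar
  multiplication.
\<close>

definition monoid_algebra :: "('a, 'm) monoid_scheme \<Rightarrow> ('k::field, 'a \<Rightarrow>\<^sub>0 'k) module" where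
  "monoid_algebra G =
    \<lparr>carrier = {p. Poly_Mapping.keys p \<subseteq> carrier G},
     mult = (\<lambda>p s. \<Sum>u\<in>Poly_Mapping.keys p. \<Sum>v\<in>Poly_Mapping.keys s.
        Poly_Mapping.single (u \<otimes>\<^bsub>G\<^esub> v) (Poly_Mapping.lookup p u * Poly_Mapping.lookup s v)),
     one = Poly_Mapping.single \<one>\<^bsub>G\<^esub> 1,
     zero = 0,
     add = (+),
     smult = (\<lambda>c. Poly_Mapping.map ((*) c))\<rparr>"

definition free_monoid :: "'x list monoid" where
  "free_monoid = \<lparr>carrier = UNIV, mult = (@), one = []\<rparr>"

abbreviation free_algebra :: "('k::field, 'x list \<Rightarrow>\<^sub>0 'k) module" where
  "free_algebra \<equiv> monoid_algebra free_monoid"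

definition quotient_algebra :: "('k, 'a, 'm) module_scheme \<Rightarrow> 'a set \<Rightarrow> ('k, 'a set) module" where
  "quotient_algebra A I =
    \<lparr>carrier = carrier (A Quot I), mult = mult (A Quot I), one = one (A Quot I),
     zero = zero (A Quot I), add = add (A Quot I),
     smult = (\<lambda>c C. \<Union>a\<in>C. I +>\<^bsub>A\<^esub> (c \<odot>\<^bsub>A\<^esub> a))\<rparr>"

definition presented_algebra ::
    "('x list \<Rightarrow>\<^sub>0 'k::field) set \<Rightarrow> ('k, ('x list \<Rightarrow>\<^sub>0 'k) set) module" where
  "presented_algebra rels =
     quotient_algebra free_algebra (genideal (free_algebra :: ('k, 'x list \<Rightarrow>\<^sub>0 'k) module) rels)"

definition gen_class ::
    "('x list \<Rightarrow>\<^sub>0 'k::field) set \<Rightarrow> 'x \<Rightarrow> ('x list \<Rightarrow>\<^sub>0 'k) set" where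
  "gen_class rels a =
     genideal (free_algebra :: ('k, 'x list \<Rightarrow>\<^sub>0 'k) module) rels
       +>\<^bsub>free_algebra :: ('k, 'x list \<Rightarrow>\<^sub>0 'k) module\<^esub> Poly_Mapping.single [a] 1"

definition linear_span :: "('k, 'a, 'm) module_scheme \<Rightarrow> 'a set \<Rightarrow> 'a set" where
  "linear_span A S =
     \<Inter>{W. additive_subgroup W A \<and> (\<forall>c. \<forall>w\<in>W. c \<odot>\<^bsub>A\<^esub> w \<in> W) \<and> S \<subseteq> W}"

text \<open>The linear extension of \<open>f\<close> from a basis to the free vector space on it.\<close>

definition lin_ext :: "('k::field, 'b, 'm) module_scheme \<Rightarrow> ('w \<Rightarrow> 'b) \<Rightarrow> ('w \<Rightarrow>\<^sub>0 'k) \<Rightarrow> 'b" where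
  "lin_ext A f p = (\<Oplus>\<^bsub>A\<^esub>w\<in>Poly_Mapping.keys p. Poly_Mapping.lookup p w \<odot>\<^bsub>A\<^esub> f w)"

text \<open>
  The linear map induced by \<open>f\<close> on a quotient of a free vector space.  It is only applied
  when the linear extension of \<open>f\<close> kills the subspace that is divided out, so that it is
  constant on each class \<open>C\<close>.
\<close>

definition induced :: "('k::field, 'b, 'm) module_scheme \<Rightarrow> ('w \<Rightarrow> 'b) \<Rightarrow> ('w \<Rightarrow>\<^sub>0 'k) set \<Rightarrow> 'b" where
  "induced A f C = the_elem (lin_ext A f ` C)"

definition word_eval :: "('b, 'm) monoid_scheme \<Rightarrow> ('x \<Rightarrow> 'b) \<Rightarrow> 'x list \<Rightarrow> 'b" where
  "word_eval A f w = foldr (\<lambda>a y. f a \<otimes>\<^bsub>A\<^esub> y) w \<one>\<^bsub>A\<^esub>"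

definition ground_algebra :: "('k::field, 'k) module" where
  "ground_algebra =
    \<lparr>carrier = UNIV, mult = (*), one = 1, zero = 0, add = (+), smult = (*)\<rparr>"


section \<open>Tensor powers of an algebra\<close>

text \<open>
  The \<open>m\<close>-th tensor power of \<open>H\<close> is the vector space on the symbols
  \<open>[a\<^sub>1, \<dots>, a\<^sub>m]\<close> with all \<open>a\<^sub>i\<close> in \<open>H\<close>, modulo the relations that make the symbol multilinear.
  The product is the componentwise one; it comes from the monoid of symbols, in which the span
  of the multilinearity relations is a two-sided ideal.
\<close>

definition symbol_monoid :: "('a, 'm) monoid_scheme \<Rightarrow> nat \<Rightarrow> 'a list monoid" where
  "symbol_monoid H m =
    \<lparr>carrier = {w. length w = m \<and> set w \<subseteq> carrier H},
     mult = map2 (mult H), one = replicate m \<one>\<^bsub>H\<^esub>\<rparr>"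

definition multilinear_rels ::
    "('k::field, 'a, 'm) module_scheme \<Rightarrow> nat \<Rightarrow> ('a list \<Rightarrow>\<^sub>0 'k) set" where
  "multilinear_rels H m =
     {Poly_Mapping.single (w[i := a \<oplus>\<^bsub>H\<^esub> b]) 1 - Poly_Mapping.single (w[i := a]) 1
        - Poly_Mapping.single (w[i := b]) 1 | w i a b.
        w \<in> carrier (symbol_monoid H m) \<and> i < m \<and> a \<in> carrier H \<and> b \<in> carrier H}
   \<union> {Poly_Mapping.single (w[i := c \<odot>\<^bsub>H\<^esub> a]) 1 - Poly_Mapping.single (w[i := a]) c | w i a c.
        w \<in> carrier (symbol_monoid H m) \<and> i < m \<and> a \<in> carrier H}"

definition tensor_null ::
    "('k::field, 'a, 'm) module_scheme \<Rightarrow> nat \<Rightarrow> ('a list \<Rightarrow>\<^sub>0 'k) set" where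
  "tensor_null H m = linear_span (monoid_algebra (symbol_monoid H m)) (multilinear_rels H m)"

definition tensor_power ::
    "('k::field, 'a, 'm) module_scheme \<Rightarrow> nat \<Rightarrow> ('k, ('a list \<Rightarrow>\<^sub>0 'k) set) module" where
  "tensor_power H m =
     quotient_algebra (monoid_algebra (symbol_monoid H m)) (tensor_null H m)"

definition pure_tensor ::
    "('k::field, 'a, 'm) module_scheme \<Rightarrow> 'a list \<Rightarrow> ('a list \<Rightarrow>\<^sub>0 'k) set" where
  "pure_tensor H w =
     tensor_null H (length w)
       +>\<^bsub>monoid_algebra (symbol_monoid H (length w)) :: ('k, 'a list \<Rightarrow>\<^sub>0 'k) module\<^esub>
       Poly_Mapping.single w 1"

definition leg12 where
  "leg12 H = induced (tensor_power H 3) (\<lambda>w. pure_tensor H [w ! 0, w ! 1, \<one>\<^bsub>H\<^esub>])"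

definition leg13 where
  "leg13 H = induced (tensor_power H 3) (\<lambda>w. pure_tensor H [w ! 0, \<one>\<^bsub>H\<^esub>, w ! 1])"

definition leg23 where
  "leg23 H = induced (tensor_power H 3) (\<lambda>w. pure_tensor H [\<one>\<^bsub>H\<^esub>, w ! 0, w ! 1])"

definition flip where
  "flip H = induced (tensor_power H 2) (\<lambda>w. pure_tensor H [w ! 1, w ! 0])"


section \<open>Quasitriangular structures and infinitesimal R-matrices\<close>

record (overloaded) ('k::zero, 'a) bialgebra = "('k, 'a) module" +
  comult :: "'a \<Rightarrow> ('a list \<Rightarrow>\<^sub>0 'k) set"
  counit :: "'a \<Rightarrow> 'k"

record (overloaded) ('k::zero, 'a) hopf_algebra = "('k, 'a) bialgebra" +
  antipode :: "'a \<Rightarrow> 'a"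

text \<open>
  The maps \<open>Id \<otimes> \<Delta>\<close> and \<open>\<Delta> \<otimes> Id\<close>, with both \<open>H \<otimes> (H \<otimes> H)\<close> and \<open>(H \<otimes> H) \<otimes> H\<close> identified with
  the third tensor power.
\<close>

definition id_comult where
  "id_comult H = induced (tensor_power H 3)
     (\<lambda>w. induced (tensor_power H 3) (\<lambda>v. pure_tensor H (w ! 0 # v)) (comult H (w ! 1)))"

definition comult_id where
  "comult_id H = induced (tensor_power H 3)
     (\<lambda>w. induced (tensor_power H 3) (\<lambda>v. pure_tensor H (v @ [w ! 1])) (comult H (w ! 0)))"

definition quasitriangular_structure ::
    "('k::field, 'a, 'm) bialgebra_scheme \<Rightarrow> ('a list \<Rightarrow>\<^sub>0 'k) set \<Rightarrow> bool" where
  "quasitriangular_structure H R \<longleftrightarrow>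
     R \<in> Units (tensor_power H 2) \<and>
     (\<forall>h\<in>carrier H. flip H (comult H h) =
        R \<otimes>\<^bsub>tensor_power H 2\<^esub> comult H h \<otimes>\<^bsub>tensor_power H 2\<^esub> inv\<^bsub>tensor_power H 2\<^esub> R) \<and>
     id_comult H R = leg13 H R \<otimes>\<^bsub>tensor_power H 3\<^esub> leg12 H R \<and>
     comult_id H R = leg13 H R \<otimes>\<^bsub>tensor_power H 3\<^esub> leg23 H R"

definition infinitesimal_R_matrix ::
    "('k::field, 'a, 'm) bialgebra_scheme \<Rightarrow> ('a list \<Rightarrow>\<^sub>0 'k) set \<Rightarrow> ('a list \<Rightarrow>\<^sub>0 'k) set \<Rightarrow> bool" where
  "infinitesimal_R_matrix H R \<chi> \<longleftrightarrow>
     \<chi> \<in> carrier (tensor_power H 2) \<and>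
     (\<forall>h\<in>carrier H. \<chi> \<otimes>\<^bsub>tensor_power H 2\<^esub> comult H h = comult H h \<otimes>\<^bsub>tensor_power H 2\<^esub> \<chi>) \<and>
     id_comult H \<chi> = leg12 H \<chi> \<oplus>\<^bsub>tensor_power H 3\<^esub>
       inv\<^bsub>tensor_power H 3\<^esub> (leg12 H R) \<otimes>\<^bsub>tensor_power H 3\<^esub> leg13 H \<chi> \<otimes>\<^bsub>tensor_power H 3\<^esub> leg12 H R \<and>
     comult_id H \<chi> = leg23 H \<chi> \<oplus>\<^bsub>tensor_power H 3\<^esub>
       inv\<^bsub>tensor_power H 3\<^esub> (leg23 H R) \<otimes>\<^bsub>tensor_power H 3\<^esub> leg13 H \<chi> \<otimes>\<^bsub>tensor_power H 3\<^esub> leg23 H R"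


section \<open>The Radford Hopf algebra\<close>

definition primitive_root_of_unity :: "nat \<Rightarrow> 'k::field \<Rightarrow> bool" where
  "primitive_root_of_unity M q \<longleftrightarrow> M > 0 \<and> q ^ M = 1 \<and> (\<forall>k. 0 < k \<and> k < M \<longrightarrow> q ^ k \<noteq> 1)"

datatype radford_gen = Gen_g | Gen_x

definition radford_rels ::
    "nat \<Rightarrow> nat \<Rightarrow> 'k::field \<Rightarrow> (radford_gen list \<Rightarrow>\<^sub>0 'k) set" where
  "radford_rels r n q =
     (let F = free_algebra;
          g = Poly_Mapping.single [Gen_g] 1;
          x = Poly_Mapping.single [Gen_x] 1
      in {g [^]\<^bsub>F\<^esub> (r * n) \<ominus>\<^bsub>F\<^esub> \<one>\<^bsub>F\<^esub>,
          x [^]\<^bsub>F\<^esub> n,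
          (x \<otimes>\<^bsub>F\<^esub> g) \<ominus>\<^bsub>F\<^esub> (q \<odot>\<^bsub>F\<^esub> (g \<otimes>\<^bsub>F\<^esub> x))})"

abbreviation radford_algebra ::
    "nat \<Rightarrow> nat \<Rightarrow> 'k::field \<Rightarrow> ('k, (radford_gen list \<Rightarrow>\<^sub>0 'k) set) module" where
  "radford_algebra r n q \<equiv> presented_algebra (radford_rels r n q)"

definition radford_comult_gen where
  "radford_comult_gen r n q a =
     (let H = radford_algebra r n q;
          g = gen_class (radford_rels r n q) Gen_g;
          x = gen_class (radford_rels r n q) Gen_x
      in case a of
           Gen_g \<Rightarrow> pure_tensor H [g, g]
         | Gen_x \<Rightarrow> pure_tensor H [\<one>\<^bsub>H\<^esub>, x] \<oplus>\<^bsub>tensor_power H 2\<^esub> pure_tensor H [x, g [^]\<^bsub>H\<^esub> r])"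

definition radford_counit_gen :: "radford_gen \<Rightarrow> 'k::field" where
  "radford_counit_gen a = (case a of Gen_g \<Rightarrow> 1 | Gen_x \<Rightarrow> 0)"

definition radford_antipode_gen where
  "radford_antipode_gen r n q a =
     (let H = radford_algebra r n q;
          g = gen_class (radford_rels r n q) Gen_g;
          x = gen_class (radford_rels r n q) Gen_x
      in case a of
           Gen_g \<Rightarrow> g [^]\<^bsub>H\<^esub> (r * n - 1)
         | Gen_x \<Rightarrow> \<ominus>\<^bsub>H\<^esub> (x \<otimes>\<^bsub>H\<^esub> (g [^]\<^bsub>H\<^esub> (r * n - r))))"

text \<open>
  The comultiplication and the counit are the algebra homomorphisms, and the antipode is the
  algebra anti-homomorphism, with the prescribed values on the generators.  They respect the
  relations when \<open>q\<close> is a primitive root of unity of order \<open>r * n\<close>: the two summands of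
  \<open>\<Delta>(x)\<close> commute up to \<open>q ^ r\<close>, which has order \<open>n\<close>, so \<open>\<Delta>(x) ^ n = 1 \<otimes> x ^ n + x ^ n \<otimes> (g ^ r) ^ n = 0\<close>.
\<close>

definition radford ::
    "nat \<Rightarrow> nat \<Rightarrow> 'k::field \<Rightarrow> ('k, (radford_gen list \<Rightarrow>\<^sub>0 'k) set) hopf_algebra" where
  "radford r n q =
     (let H = radford_algebra r n q in
      \<lparr>carrier = carrier H, mult = mult H, one = one H, zero = zero H, add = add H,
       smult = smult H,
       comult = induced (tensor_power H 2)
         (word_eval (tensor_power H 2) (radford_comult_gen r n q)),
       counit = induced ground_algebra (word_eval ground_algebra radford_counit_gen),
       antipode = induced H (\<lambda>w. word_eval H (radford_antipode_gen r n q) (rev w))\<rparr>)"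

end

theory Submission
  imports Defs "HOL-Computational_Algebra.Primes"
begin

text \<open>
  An infinitesimal R-matrix \<open>\<chi>\<close> commutes with \<open>\<Delta>(g) = g \<otimes> g\<close>, and conjugation by \<open>g \<otimes> g\<close> scales
  \<open>g ^ l x ^ m \<otimes> g ^ l' x ^ m'\<close> by a power of \<open>q\<close> with exponent \<open>\<plusminus>(m + m')\<close>.  As
  \<open>m + m' \<le> 2n - 2 < rn = M\<close>, only \<open>m = m' = 0\<close> survives, so \<open>\<chi>\<close> lies in the span of the \<open>g ^ l \<otimes> g ^ l'\<close>
  and is determined by the scalars \<open>\<chi>(a, b) = (\<phi>\<^sub>a \<otimes> \<phi>\<^sub>b)(\<chi>)\<close>, where \<open>\<phi>\<^sub>a\<close> is the character \<open>g \<mapsto> q ^ a\<close>,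
  \<open>x \<mapsto> 0\<close>.  Applying \<open>\<phi>\<^sub>a \<otimes> \<phi>\<^sub>b \<otimes> \<phi>\<^sub>c\<close> to the formula for \<open>(Id \<otimes> \<Delta>)(\<chi>)\<close>, the conjugation by \<open>R\<close>
  disappears because the target is commutative, and one gets \<open>\<chi>(a, b + c) = \<chi>(a, b) + \<chi>(a, c)\<close>.
  Hence \<open>M \<chi>(a, b) = \<chi>(a, M b) = \<chi>(a, 0) = 0\<close>, and \<open>M\<close> is invertible since a primitive \<open>M\<close>-th root
  of unity exists.
\<close>


section \<open>Algebras and linear maps\<close>

text \<open>The presented algebra is shown to be spanned by the monomials g^l x^m, and the argument
  never appeals to their linear independence. Hence "only m = m' = 0 survives" cannot be read off
  from coefficients. Two linear operators on H \<otimes> H are compared instead: the sum of the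
  conjugations by the powers of g \<otimes> g, and a discrete Fourier sum built from the scalars
  \<chi>(a, b). Being linear, they need only be evaluated on pure tensors of monomials. On an
  element that commutes with g \<otimes> g the first operator is multiplication by M, and the second
  vanishes as soon as all the scalars do. This is the sense in which \<chi> is determined by them.
  The rest of the work is well-definedness. Each map out of a tensor power or a presented algebra is
  given by \<open>induced\<close>, which is meaningful only after multilinearity or the relations
  have been checked. For the comultiplication this means \<Delta>(x)^n = 0, which is why the quantum
  binomial formula at a root of unity appears. The value \<chi>(a, 0) = 0 comes from the additivity
  in the second argument, taken at 0 + 0.\<close>

locale k_algebra = ring A for A :: "('k::field, 'a, 'm) module_scheme" (structure) +
  assumes smult_closed [simp, intro]: "a \<in> carrier A \<Longrightarrow> c \<odot> a \<in> carrier A"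
    and smult_l_distr: "a \<in> carrier A \<Longrightarrow> (c + d) \<odot> a = c \<odot> a \<oplus> d \<odot> a"
    and smult_r_distr: "a \<in> carrier A \<Longrightarrow> b \<in> carrier A \<Longrightarrow> c \<odot> (a \<oplus> b) = c \<odot> a \<oplus> c \<odot> b"
    and smult_smult: "a \<in> carrier A \<Longrightarrow> c \<odot> (d \<odot> a) = (c * d) \<odot> a"
    and smult_one [simp]: "a \<in> carrier A \<Longrightarrow> 1 \<odot> a = a"
    and smult_mult_left: "a \<in> carrier A \<Longrightarrow> b \<in> carrier A \<Longrightarrow> (c \<odot> a) \<otimes> b = c \<odot> (a \<otimes> b)"
    and smult_mult_right: "a \<in> carrier A \<Longrightarrow> b \<in> carrier A \<Longrightarrow> a \<otimes> (c \<odot> b) = c \<odot> (a \<otimes> b)"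
begin

lemma smult_zero_left [simp]: "a \<in> carrier A \<Longrightarrow> 0 \<odot> a = \<zero>"
  using smult_l_distr[of a 0 0] by (metis add.l_cancel_one' add_0 smult_closed)

lemma smult_zero_right [simp]: "c \<odot> \<zero> = \<zero>"
  using smult_r_distr[of \<zero> \<zero> c] by (metis add.l_cancel_one' l_zero smult_closed zero_closed)

lemma smult_minus_one: "a \<in> carrier A \<Longrightarrow> (- 1) \<odot> a = \<ominus> a"
proof -
  assume a: "a \<in> carrier A"
  then have "(- 1) \<odot> a \<oplus> a = \<zero>"
    using smult_l_distr[of a "- 1" 1] by simp
  then show ?thesis
    using a by (simp add: minus_equality)
qed

lemma add_minus_minus:
  assumes "a \<in> carrier A" "b \<in> carrier A"
  shows "a \<oplus> b \<ominus> a \<ominus> b = \<zero>"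
  using r_neg[of "a \<oplus> b"] assms by (simp add: a_minus_def minus_add a_assoc)

lemma smult_finsum:
  "f \<in> S \<rightarrow> carrier A \<Longrightarrow> c \<odot> (\<Oplus>i\<in>S. f i) = (\<Oplus>i\<in>S. c \<odot> f i)"
proof (induction S rule: infinite_finite_induct)
  case (insert i S)
  then have "(\<lambda>i. c \<odot> f i) \<in> S \<rightarrow> carrier A" "f \<in> S \<rightarrow> carrier A" "f i \<in> carrier A"
    by auto
  with insert show ?case by (simp add: smult_r_distr)
qed auto

lemma finsum_smult_const:
  "finite S \<Longrightarrow> a \<in> carrier A \<Longrightarrow> (\<Oplus>i\<in>S. f i \<odot> a) = (\<Sum>i\<in>S. f i) \<odot> a"
proof (induction S rule: finite_induct)
  case (insert i S)
  have "(\<lambda>i. f i \<odot> a) \<in> S \<rightarrow> carrier A" using insert.prems by auto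
  with insert show ?case by (simp add: smult_l_distr)
qed auto

lemma smult_cancel_zero:
  assumes "a \<in> carrier A" "c \<noteq> 0" "c \<odot> a = \<zero>"
  shows "a = \<zero>"
proof -
  have "inverse c \<odot> (c \<odot> a) = a"
    using assms(1,2) by (simp add: smult_smult)
  then show ?thesis using assms(3) by simp
qed

end

text \<open>All axioms are equations or existence statements, so they pass along a surjection that
  respects the operations; nothing is assumed of \<open>B\<close> beforehand. This serves for
  quotients and, with the identity as surjection, for a change of record type.\<close>

lemma k_algebra_image:
  fixes B :: "('k::field, 'b, 'n) module_scheme"
  assumes A: "k_algebra A" and onto: "\<pi> ` carrier A = carrier B"
    and one: "\<pi> \<one>\<^bsub>A\<^esub> = \<one>\<^bsub>B\<^esub>" and zero: "\<pi> \<zero>\<^bsub>A\<^esub> = \<zero>\<^bsub>B\<^esub>"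
    and add: "\<And>a b. a \<in> carrier A \<Longrightarrow> b \<in> carrier A \<Longrightarrow> \<pi> a \<oplus>\<^bsub>B\<^esub> \<pi> b = \<pi> (a \<oplus>\<^bsub>A\<^esub> b)"
    and mult: "\<And>a b. a \<in> carrier A \<Longrightarrow> b \<in> carrier A \<Longrightarrow> \<pi> a \<otimes>\<^bsub>B\<^esub> \<pi> b = \<pi> (a \<otimes>\<^bsub>A\<^esub> b)"
    and smult: "\<And>a c. a \<in> carrier A \<Longrightarrow> c \<odot>\<^bsub>B\<^esub> \<pi> a = \<pi> (c \<odot>\<^bsub>A\<^esub> a)"
  shows "k_algebra B"
proof -
  interpret A: k_algebra A by (rule A)
  have ex: "\<exists>a\<in>carrier A. y = \<pi> a" if "y \<in> carrier B" for y
    using that onto by auto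
  have cl: "\<pi> a \<in> carrier B" if "a \<in> carrier A" for a
    using that onto by auto
  note [simp] = one[symmetric] zero[symmetric] add mult smult
  have "abelian_group B"
  proof (rule abelian_groupI)
    fix y assume "y \<in> carrier B"
    then obtain a where "a \<in> carrier A" "y = \<pi> a" using ex by blast
    then show "\<exists>z\<in>carrier B. z \<oplus>\<^bsub>B\<^esub> y = \<zero>\<^bsub>B\<^esub>"
      by (intro bexI[of _ "\<pi> (\<ominus>\<^bsub>A\<^esub> a)"]) (auto simp: A.l_neg intro: cl)
  qed (auto dest!: ex intro!: cl simp: A.a_ac)
  moreover have "monoid B"
    by (rule monoidI) (auto dest!: ex intro!: cl simp: A.m_assoc)
  ultimately have "ring B"
    by (rule ringI) (auto dest!: ex intro!: cl simp: A.l_distr A.r_distr)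
  then show ?thesis
    by (intro k_algebra.intro k_algebra_axioms.intro)
      (auto dest!: ex intro!: cl simp: A.smult_l_distr A.smult_r_distr A.smult_smult
        A.smult_mult_left A.smult_mult_right)
qed

lemma k_algebra_ground: "k_algebra (ground_algebra :: ('k::field, 'k) module)"
proof -
  have "abelian_group (ground_algebra :: ('k, 'k) module)"
    by (rule abelian_groupI) (auto simp: ground_algebra_def intro: exI[of _ "- _"])
  moreover have "monoid (ground_algebra :: ('k, 'k) module)"
    by (rule monoidI) (auto simp: ground_algebra_def)
  ultimately have "ring (ground_algebra :: ('k, 'k) module)"
    by (rule ringI) (auto simp: ground_algebra_def algebra_simps)
  then show ?thesis
    by (intro k_algebra.intro k_algebra_axioms.intro)
      (auto simp: ground_algebra_def algebra_simps)
qed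

lemma ground_algebra_simps [simp]:
  "carrier ground_algebra = UNIV" "mult ground_algebra = (*)" "one ground_algebra = 1"
  "zero ground_algebra = 0" "add ground_algebra = (+)" "smult ground_algebra = (*)"
  by (simp_all add: ground_algebra_def)

section \<open>Linear maps and algebra homomorphisms\<close>

definition linear_map ::
    "('k, 'a, 'm) module_scheme \<Rightarrow> ('k, 'b, 'n) module_scheme \<Rightarrow> ('a \<Rightarrow> 'b) \<Rightarrow> bool" where
  "linear_map A B h \<longleftrightarrow> h \<in> carrier A \<rightarrow> carrier B \<and>
     (\<forall>a\<in>carrier A. \<forall>b\<in>carrier A. h (a \<oplus>\<^bsub>A\<^esub> b) = h a \<oplus>\<^bsub>B\<^esub> h b) \<and>
     (\<forall>a\<in>carrier A. \<forall>c. h (c \<odot>\<^bsub>A\<^esub> a) = c \<odot>\<^bsub>B\<^esub> h a)"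

definition algebra_hom ::
    "('k, 'a, 'm) module_scheme \<Rightarrow> ('k, 'b, 'n) module_scheme \<Rightarrow> ('a \<Rightarrow> 'b) \<Rightarrow> bool" where
  "algebra_hom A B h \<longleftrightarrow> linear_map A B h \<and> h \<in> ring_hom A B"

definition linear_subspace :: "('k, 'a, 'm) module_scheme \<Rightarrow> 'a set \<Rightarrow> bool" where
  "linear_subspace A W \<longleftrightarrow> additive_subgroup W A \<and> (\<forall>c. \<forall>w\<in>W. c \<odot>\<^bsub>A\<^esub> w \<in> W)"

lemma linear_mapI:
  assumes "\<And>a. a \<in> carrier A \<Longrightarrow> h a \<in> carrier B"
    and "\<And>a b. a \<in> carrier A \<Longrightarrow> b \<in> carrier A \<Longrightarrow> h (a \<oplus>\<^bsub>A\<^esub> b) = h a \<oplus>\<^bsub>B\<^esub> h b"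
    and "\<And>a c. a \<in> carrier A \<Longrightarrow> h (c \<odot>\<^bsub>A\<^esub> a) = c \<odot>\<^bsub>B\<^esub> h a"
  shows "linear_map A B h"
  using assms by (auto simp: linear_map_def)

lemma
  assumes "linear_map A B h"
  shows linear_map_closed: "a \<in> carrier A \<Longrightarrow> h a \<in> carrier B"
    and linear_map_add: "a \<in> carrier A \<Longrightarrow> b \<in> carrier A \<Longrightarrow> h (a \<oplus>\<^bsub>A\<^esub> b) = h a \<oplus>\<^bsub>B\<^esub> h b"
    and linear_map_smult: "a \<in> carrier A \<Longrightarrow> h (c \<odot>\<^bsub>A\<^esub> a) = c \<odot>\<^bsub>B\<^esub> h a"
  using assms by (auto simp: linear_map_def)

lemma algebra_homI:
  assumes "linear_map A B h"
    and "\<And>a b. a \<in> carrier A \<Longrightarrow> b \<in> carrier A \<Longrightarrow> h (a \<otimes>\<^bsub>A\<^esub> b) = h a \<otimes>\<^bsub>B\<^esub> h b"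
    and "h \<one>\<^bsub>A\<^esub> = \<one>\<^bsub>B\<^esub>"
  shows "algebra_hom A B h"
  using assms by (auto simp: algebra_hom_def ring_hom_def linear_map_def)

lemma
  assumes "algebra_hom A B h"
  shows algebra_hom_linear: "linear_map A B h"
    and algebra_hom_mult: "a \<in> carrier A \<Longrightarrow> b \<in> carrier A \<Longrightarrow> h (a \<otimes>\<^bsub>A\<^esub> b) = h a \<otimes>\<^bsub>B\<^esub> h b"
    and algebra_hom_one: "h \<one>\<^bsub>A\<^esub> = \<one>\<^bsub>B\<^esub>"
  using assms by (auto simp: algebra_hom_def ring_hom_def)

lemma linear_map_comp: "linear_map A B h \<Longrightarrow> linear_map B C k \<Longrightarrow> linear_map A C (\<lambda>a. k (h a))"
  by (auto simp: linear_map_def Pi_iff)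

lemma algebra_hom_comp: "algebra_hom A B h \<Longrightarrow> algebra_hom B C k \<Longrightarrow> algebra_hom A C (\<lambda>a. k (h a))"
  by (auto simp: algebra_hom_def linear_map_def ring_hom_def Pi_iff)

lemma linear_map_zero:
  assumes "k_algebra A" "k_algebra B" "linear_map A B h"
  shows "h \<zero>\<^bsub>A\<^esub> = \<zero>\<^bsub>B\<^esub>"
proof -
  interpret A: k_algebra A by fact
  interpret B: k_algebra B by fact
  have "h (0 \<odot>\<^bsub>A\<^esub> \<zero>\<^bsub>A\<^esub>) = 0 \<odot>\<^bsub>B\<^esub> h \<zero>\<^bsub>A\<^esub>"
    by (intro linear_map_smult[OF assms(3)]) auto
  then show ?thesis using linear_map_closed[OF assms(3), of "\<zero>\<^bsub>A\<^esub>"] by simp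
qed

lemma linear_map_minus:
  assumes "k_algebra A" "k_algebra B" "linear_map A B h" "a \<in> carrier A" "b \<in> carrier A"
  shows "h (a \<ominus>\<^bsub>A\<^esub> b) = h a \<ominus>\<^bsub>B\<^esub> h b"
proof -
  interpret A: k_algebra A by fact
  interpret B: k_algebra B by fact
  show ?thesis
    using assms(3-) linear_map_closed[OF assms(3)]
    by (simp add: a_minus_def A.smult_minus_one[symmetric] B.smult_minus_one[symmetric]
        linear_map_add linear_map_smult)
qed

lemma algebra_hom_pow:
  assumes "k_algebra A" "k_algebra B" "algebra_hom A B h" "a \<in> carrier A"
  shows "h (a [^]\<^bsub>A\<^esub> (m::nat)) = h a [^]\<^bsub>B\<^esub> m"
proof -
  interpret A: k_algebra A by fact
  interpret B: k_algebra B by fact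
  show ?thesis
    using assms(3-) by (induction m) (auto simp: algebra_hom_mult algebra_hom_one)
qed

lemma linear_map_sum:
  assumes "k_algebra B" "linear_map A B h" "linear_map A B k"
  shows "linear_map A B (\<lambda>a. h a \<oplus>\<^bsub>B\<^esub> k a)"
proof -
  interpret B: k_algebra B by fact
  show ?thesis
    using linear_map_closed[OF assms(2)] linear_map_closed[OF assms(3)]
    by (intro linear_mapI)
      (auto simp: linear_map_add[OF assms(2)] linear_map_add[OF assms(3)] B.a_ac
        linear_map_smult[OF assms(2)] linear_map_smult[OF assms(3)] B.smult_r_distr)
qed

lemma linear_map_scale:
  assumes "k_algebra B" "linear_map A B h"
  shows "linear_map A B (\<lambda>a. c \<odot>\<^bsub>B\<^esub> h a)"
proof -
  interpret B: k_algebra B by fact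
  show ?thesis
    using linear_map_closed[OF assms(2)]
    by (intro linear_mapI)
      (auto simp: linear_map_add[OF assms(2)] linear_map_smult[OF assms(2)]
         B.smult_r_distr B.smult_smult mult.commute)
qed

lemma linear_map_finsum:
  assumes "k_algebra A" "k_algebra B" and "\<And>i. i \<in> S \<Longrightarrow> linear_map A B (h i)"
  shows "linear_map A B (\<lambda>a. \<Oplus>\<^bsub>B\<^esub>i\<in>S. h i a)"
proof -
  interpret B: k_algebra B by fact
  interpret A: k_algebra A by fact
  have cl: "(\<lambda>i. h i a) \<in> S \<rightarrow> carrier B" if "a \<in> carrier A" for a
    using assms(3) that by (auto intro: linear_map_closed)
  show ?thesis
  proof (rule linear_mapI)
    fix a b assume ab: "a \<in> carrier A" "b \<in> carrier A"
    have "(\<Oplus>\<^bsub>B\<^esub>i\<in>S. h i (a \<oplus>\<^bsub>A\<^esub> b)) = (\<Oplus>\<^bsub>B\<^esub>i\<in>S. h i a \<oplus>\<^bsub>B\<^esub> h i b)"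
      using ab cl assms(3) by (intro B.finsum_cong') (auto simp: linear_map_add)
    then show "(\<Oplus>\<^bsub>B\<^esub>i\<in>S. h i (a \<oplus>\<^bsub>A\<^esub> b)) = (\<Oplus>\<^bsub>B\<^esub>i\<in>S. h i a) \<oplus>\<^bsub>B\<^esub> (\<Oplus>\<^bsub>B\<^esub>i\<in>S. h i b)"
      using ab cl by (simp add: B.finsum_addf)
  next
    fix a c assume a: "a \<in> carrier A"
    have "(\<Oplus>\<^bsub>B\<^esub>i\<in>S. h i (c \<odot>\<^bsub>A\<^esub> a)) = (\<Oplus>\<^bsub>B\<^esub>i\<in>S. c \<odot>\<^bsub>B\<^esub> h i a)"
      using a cl assms(3) by (intro B.finsum_cong') (auto simp: linear_map_smult)
    then show "(\<Oplus>\<^bsub>B\<^esub>i\<in>S. h i (c \<odot>\<^bsub>A\<^esub> a)) = c \<odot>\<^bsub>B\<^esub> (\<Oplus>\<^bsub>B\<^esub>i\<in>S. h i a)"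
      using a cl by (simp add: B.smult_finsum)
  qed (use cl in auto)
qed

lemma linear_map_mult:
  assumes "k_algebra A" "u \<in> carrier A" "v \<in> carrier A"
  shows "linear_map A A (\<lambda>a. u \<otimes>\<^bsub>A\<^esub> a \<otimes>\<^bsub>A\<^esub> v)"
proof -
  interpret A: k_algebra A by fact
  show ?thesis
    using assms(2-)
    by (intro linear_mapI)
      (auto simp: A.l_distr A.r_distr A.smult_mult_left A.smult_mult_right)
qed

lemma linear_map_vector:
  assumes "k_algebra B" "linear_map A ground_algebra h" "v \<in> carrier B"
  shows "linear_map A B (\<lambda>a. h a \<odot>\<^bsub>B\<^esub> v)"
proof -
  interpret B: k_algebra B by fact
  show ?thesis
    using assms(2-)
    by (intro linear_mapI)
      (auto simp: linear_map_add linear_map_smult B.smult_l_distr B.smult_smult)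
qed

section \<open>Linear subspaces, equalizers and spans\<close>

lemma linear_subspaceI:
  assumes "k_algebra A" "W \<subseteq> carrier A" "\<zero>\<^bsub>A\<^esub> \<in> W"
    and "\<And>a b. a \<in> W \<Longrightarrow> b \<in> W \<Longrightarrow> a \<oplus>\<^bsub>A\<^esub> b \<in> W"
    and "\<And>a c. a \<in> W \<Longrightarrow> c \<odot>\<^bsub>A\<^esub> a \<in> W"
  shows "linear_subspace A W"
proof -
  interpret A: k_algebra A by fact
  \<comment> \<open>Negatives are multiples by -1, so closure under scalars already yields a
    subgroup.\<close>
  have "\<ominus>\<^bsub>A\<^esub> a \<in> W" if "a \<in> W" for a
    using that assms(2,5) A.smult_minus_one by (metis subsetD)
  then have "subgroup W (add_monoid A)"
    using assms by (intro A.add.subgroupI) (auto simp: a_inv_def)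
  then show ?thesis
    using assms(5) by (auto simp: linear_subspace_def intro: additive_subgroupI)
qed

lemma
  assumes "linear_subspace A W"
  shows linear_subspace_zero: "\<zero>\<^bsub>A\<^esub> \<in> W"
    and linear_subspace_add: "a \<in> W \<Longrightarrow> b \<in> W \<Longrightarrow> a \<oplus>\<^bsub>A\<^esub> b \<in> W"
    and linear_subspace_smult: "a \<in> W \<Longrightarrow> c \<odot>\<^bsub>A\<^esub> a \<in> W"
  using assms additive_subgroup.zero_closed additive_subgroup.a_closed
  by (fastforce simp: linear_subspace_def)+

text \<open>This is how equality of linear maps is proved below: a subspace that contains a spanning
  set is everything.\<close>

lemma equalizer_linear_subspace:
  assumes "k_algebra A" "k_algebra B" "linear_map A B h" "linear_map A B k"
  shows "linear_subspace A {a \<in> carrier A. h a = k a}"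
proof -
  interpret A: k_algebra A by fact
  show ?thesis
    by (rule linear_subspaceI[OF assms(1)])
      (auto simp: linear_map_zero[OF assms(1,2,3)] linear_map_zero[OF assms(1,2,4)]
        linear_map_add[OF assms(3)] linear_map_add[OF assms(4)]
        linear_map_smult[OF assms(3)] linear_map_smult[OF assms(4)])
qed

lemma kernel_linear_subspace:
  assumes "k_algebra A" "k_algebra B" "linear_map A B h"
  shows "linear_subspace A {a \<in> carrier A. h a = \<zero>\<^bsub>B\<^esub>}"
proof -
  interpret B: k_algebra B by fact
  have "linear_map A B (\<lambda>_. \<zero>\<^bsub>B\<^esub>)"
    by (auto intro: linear_mapI)
  then show ?thesis
    using equalizer_linear_subspace[OF assms] by blast
qed

lemma linear_span_least: "linear_subspace A W \<Longrightarrow> S \<subseteq> W \<Longrightarrow> linear_span A S \<subseteq> W"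
  by (auto simp: linear_span_def linear_subspace_def)

lemma linear_span_superset: "S \<subseteq> linear_span A S"
  by (auto simp: linear_span_def)

lemma linear_subspace_carrier:
  assumes "k_algebra A"
  shows "linear_subspace A (carrier A)"
proof -
  interpret A: k_algebra A by fact
  show ?thesis by (rule linear_subspaceI[OF assms]) auto
qed

lemma linear_subspace_linear_span:
  assumes "k_algebra A" "S \<subseteq> carrier A"
  shows "linear_subspace A (linear_span A S)"
proof -
  have eq: "linear_span A S = \<Inter>{W. linear_subspace A W \<and> S \<subseteq> W}"
    by (auto simp: linear_span_def linear_subspace_def)
  show ?thesis
    \<comment> \<open>The carrier is a member of the family, so the intersection is taken over a
      non-empty family and stays inside the carrier.\<close>
    unfolding eq using linear_subspace_carrier[OF assms(1)] assms(2)
    by (intro linear_subspaceI[OF assms(1)])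
      (auto intro: linear_subspace_zero linear_subspace_add linear_subspace_smult)
qed

section \<open>Monoid algebras and their quotients\<close>

text \<open>A finitely supported function is the finite sum of its one-point parts. The support
  condition is carried through the induction so that the additive step may assume it for both
  summands.\<close>

lemma poly_mapping_carrier_induct [consumes 1, case_names zero add single]:
  fixes p :: "'a \<Rightarrow>\<^sub>0 'k::comm_monoid_add"
  assumes p: "Poly_Mapping.keys p \<subseteq> S"
    and zero: "P 0"
    and add: "\<And>p s. Poly_Mapping.keys p \<subseteq> S \<Longrightarrow> Poly_Mapping.keys s \<subseteq> S \<Longrightarrow> P p \<Longrightarrow> P s \<Longrightarrow> P (p + s)"
    and single: "\<And>u c. u \<in> S \<Longrightarrow> P (Poly_Mapping.single u c)"
  shows "P p"
proof -
  have eq: "p = (\<Sum>u\<in>Poly_Mapping.keys p. Poly_Mapping.single u (Poly_Mapping.lookup p u))"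
    by (rule poly_mapping_eqI)
      (auto simp: lookup_sum lookup_single when_def in_keys_iff sum.delta)
  have "Poly_Mapping.keys (\<Sum>u\<in>T. Poly_Mapping.single u (Poly_Mapping.lookup p u)) \<subseteq> S \<and>
      P (\<Sum>u\<in>T. Poly_Mapping.single u (Poly_Mapping.lookup p u))"
    if "finite T" "T \<subseteq> S" for T
    using that
  proof (induction T rule: finite_induct)
    case (insert u T)
    have "Poly_Mapping.keys (Poly_Mapping.single u (Poly_Mapping.lookup p u)) \<subseteq> S"
      using insert.prems by auto
    with insert show ?case
      using Poly_Mapping.keys_add[of "Poly_Mapping.single u (Poly_Mapping.lookup p u)"
        "\<Sum>u\<in>T. Poly_Mapping.single u (Poly_Mapping.lookup p u)"]
      by (auto intro!: add single)
  qed (auto intro: zero)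
  from this[OF finite_keys p] show ?thesis
    using eq by simp
qed

lemma monoid_algebra_simps [simp]:
  "carrier (monoid_algebra G) = {p. Poly_Mapping.keys p \<subseteq> carrier G}"
  "one (monoid_algebra G) = Poly_Mapping.single \<one>\<^bsub>G\<^esub> 1"
  "zero (monoid_algebra G) = 0"
  "add (monoid_algebra G) = (+)"
  "smult (monoid_algebra G) = (\<lambda>c. Poly_Mapping.map ((*) c))"
  by (simp_all add: monoid_algebra_def)

lemma lookup_scale [simp]:
  fixes c :: "'k::field"
  shows "Poly_Mapping.lookup (Poly_Mapping.map ((*) c) p) u = c * Poly_Mapping.lookup p u"
  by (simp add: map.rep_eq when_def)

lemma keys_scale_subset: "Poly_Mapping.keys (Poly_Mapping.map ((*) (c::'k::field)) p) \<subseteq> Poly_Mapping.keys p"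
  by (auto simp: in_keys_iff)

lemma scale_single [simp]:
  "Poly_Mapping.map ((*) (c::'k::field)) (Poly_Mapping.single u d) = Poly_Mapping.single u (c * d)"
  by (rule poly_mapping_eqI) (auto simp: lookup_single when_def)

lemma scale_add [simp]:
  "Poly_Mapping.map ((*) (c::'k::field)) (p + s) =
    Poly_Mapping.map ((*) c) p + Poly_Mapping.map ((*) c) s"
  by (rule poly_mapping_eqI) (auto simp: lookup_add algebra_simps)

lemma scale_zero [simp]: "Poly_Mapping.map ((*) (c::'k::field)) 0 = 0"
  by (rule poly_mapping_eqI) simp

text \<open>The definition sums over the exact supports, and these change when elements are added.
  Over one fixed larger index set, additivity of the product can be checked term by term.\<close>

lemma monoid_algebra_mult_superset:
  assumes "finite S" "finite T" "Poly_Mapping.keys p \<subseteq> S" "Poly_Mapping.keys s \<subseteq> T"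
  shows "p \<otimes>\<^bsub>monoid_algebra G\<^esub> s = (\<Sum>u\<in>S. \<Sum>v\<in>T.
    Poly_Mapping.single (u \<otimes>\<^bsub>G\<^esub> v) (Poly_Mapping.lookup p u * Poly_Mapping.lookup s v))"
proof -
  have "(\<Sum>v\<in>Poly_Mapping.keys s.
      Poly_Mapping.single (u \<otimes>\<^bsub>G\<^esub> v) (Poly_Mapping.lookup p u * Poly_Mapping.lookup s v)) =
    (\<Sum>v\<in>T.
      Poly_Mapping.single (u \<otimes>\<^bsub>G\<^esub> v) (Poly_Mapping.lookup p u * Poly_Mapping.lookup s v))" for u
    using assms by (intro sum.mono_neutral_left) (auto simp: in_keys_iff)
  moreover have "(\<Sum>u\<in>Poly_Mapping.keys p. \<Sum>v\<in>T.
      Poly_Mapping.single (u \<otimes>\<^bsub>G\<^esub> v) (Poly_Mapping.lookup p u * Poly_Mapping.lookup s v)) =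
    (\<Sum>u\<in>S. \<Sum>v\<in>T.
      Poly_Mapping.single (u \<otimes>\<^bsub>G\<^esub> v) (Poly_Mapping.lookup p u * Poly_Mapping.lookup s v))"
    using assms by (intro sum.mono_neutral_left) (auto simp: in_keys_iff)
  ultimately show ?thesis
    by (simp add: monoid_algebra_def)
qed

lemma monoid_algebra_mult_add_left:
  "(p + p') \<otimes>\<^bsub>monoid_algebra G\<^esub> s = p \<otimes>\<^bsub>monoid_algebra G\<^esub> s + p' \<otimes>\<^bsub>monoid_algebra G\<^esub> s"
proof -
  let ?S = "Poly_Mapping.keys p \<union> Poly_Mapping.keys p'"
  note mult = monoid_algebra_mult_superset[where S = ?S and T = "Poly_Mapping.keys s"]
  show ?thesis
    using Poly_Mapping.keys_add[of p p']
    by (simp add: mult lookup_add distrib_right single_add sum.distrib)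
qed

lemma monoid_algebra_mult_add_right:
  "p \<otimes>\<^bsub>monoid_algebra G\<^esub> (s + s') = p \<otimes>\<^bsub>monoid_algebra G\<^esub> s + p \<otimes>\<^bsub>monoid_algebra G\<^esub> s'"
proof -
  let ?T = "Poly_Mapping.keys s \<union> Poly_Mapping.keys s'"
  note mult = monoid_algebra_mult_superset[where T = ?T and S = "Poly_Mapping.keys p"]
  show ?thesis
    using Poly_Mapping.keys_add[of s s']
    by (simp add: mult lookup_add distrib_left single_add sum.distrib)
qed

lemma monoid_algebra_mult_zero [simp]:
  "0 \<otimes>\<^bsub>monoid_algebra G\<^esub> s = 0" "s \<otimes>\<^bsub>monoid_algebra G\<^esub> 0 = 0"
  by (simp_all add: monoid_algebra_def)

lemma monoid_algebra_mult_single [simp]: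
  "Poly_Mapping.single u c \<otimes>\<^bsub>monoid_algebra G\<^esub> Poly_Mapping.single v d =
    Poly_Mapping.single (u \<otimes>\<^bsub>G\<^esub> v) (c * d)"
  using monoid_algebra_mult_superset[of "{u}" "{v}" "Poly_Mapping.single u c" "Poly_Mapping.single v d" G]
  by simp

text \<open>Both sides of each identity are additive in every argument, so nested inductions reduce
  it to one-point functions, where it is an identity in \<open>G\<close> and in the field.\<close>

lemma k_algebra_monoid_algebra:
  fixes G :: "('a, 'm) monoid_scheme"
  assumes "monoid G"
  shows "k_algebra (monoid_algebra G :: ('k::field, 'a \<Rightarrow>\<^sub>0 'k) module)"
proof -
  interpret G: monoid G by fact
  let ?A = "monoid_algebra G :: ('k, 'a \<Rightarrow>\<^sub>0 'k) module"
  note distribs = monoid_algebra_mult_add_left monoid_algebra_mult_add_right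
  have keys_add: "Poly_Mapping.keys (p + s) \<subseteq> carrier G"
    if "Poly_Mapping.keys p \<subseteq> carrier G" "Poly_Mapping.keys s \<subseteq> carrier G" for p s :: "'a \<Rightarrow>\<^sub>0 'k"
    using that Poly_Mapping.keys_add[of p s] by auto
  have closed: "Poly_Mapping.keys (p \<otimes>\<^bsub>?A\<^esub> s) \<subseteq> carrier G"
    if p: "Poly_Mapping.keys p \<subseteq> carrier G" and s: "Poly_Mapping.keys s \<subseteq> carrier G" for p s
    using p
  proof (induction p rule: poly_mapping_carrier_induct)
    case (single u c)
    from s show ?case
      by (induction s rule: poly_mapping_carrier_induct)
        (use single keys_add in \<open>auto simp: distribs\<close>)
  qed (use keys_add in \<open>auto simp: distribs\<close>)
  have assoc: "p \<otimes>\<^bsub>?A\<^esub> s \<otimes>\<^bsub>?A\<^esub> t = p \<otimes>\<^bsub>?A\<^esub> (s \<otimes>\<^bsub>?A\<^esub> t)"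
    if p: "Poly_Mapping.keys p \<subseteq> carrier G" and s: "Poly_Mapping.keys s \<subseteq> carrier G"
      and t: "Poly_Mapping.keys t \<subseteq> carrier G" for p s t
    using p
  proof (induction p rule: poly_mapping_carrier_induct)
    case (single u c)
    note u = this
    from s show ?case
    proof (induction s rule: poly_mapping_carrier_induct)
      case (single v d)
      from t show ?case
        by (induction t rule: poly_mapping_carrier_induct)
          (use single u in \<open>auto simp: distribs G.m_assoc mult.assoc\<close>)
    qed (auto simp: distribs)
  qed (auto simp: distribs)
  have l_one: "Poly_Mapping.single \<one>\<^bsub>G\<^esub> 1 \<otimes>\<^bsub>?A\<^esub> p = p"
    and r_one: "p \<otimes>\<^bsub>?A\<^esub> Poly_Mapping.single \<one>\<^bsub>G\<^esub> 1 = p"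
    if "Poly_Mapping.keys p \<subseteq> carrier G" for p
    using that by (induction p rule: poly_mapping_carrier_induct) (auto simp: distribs)
  have smult_left: "Poly_Mapping.map ((*) c) p \<otimes>\<^bsub>?A\<^esub> s = Poly_Mapping.map ((*) c) (p \<otimes>\<^bsub>?A\<^esub> s)"
    and smult_right: "p \<otimes>\<^bsub>?A\<^esub> Poly_Mapping.map ((*) c) s = Poly_Mapping.map ((*) c) (p \<otimes>\<^bsub>?A\<^esub> s)"
    if p: "Poly_Mapping.keys p \<subseteq> carrier G" and s: "Poly_Mapping.keys s \<subseteq> carrier G" for p s c
  proof -
    show "Poly_Mapping.map ((*) c) p \<otimes>\<^bsub>?A\<^esub> s = Poly_Mapping.map ((*) c) (p \<otimes>\<^bsub>?A\<^esub> s)"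
      using p
    proof (induction p rule: poly_mapping_carrier_induct)
      case (single u c)
      from s show ?case
        by (induction s rule: poly_mapping_carrier_induct)
          (use single in \<open>auto simp: distribs mult.assoc\<close>)
    qed (auto simp: distribs)
    show "p \<otimes>\<^bsub>?A\<^esub> Poly_Mapping.map ((*) c) s = Poly_Mapping.map ((*) c) (p \<otimes>\<^bsub>?A\<^esub> s)"
      using p
    proof (induction p rule: poly_mapping_carrier_induct)
      case (single u c)
      from s show ?case
        by (induction s rule: poly_mapping_carrier_induct)
          (use single in \<open>auto simp: distribs mult.left_commute\<close>)
    qed (auto simp: distribs)
  qed
  have "abelian_group ?A"
  proof (rule abelian_groupI)
    fix p assume "p \<in> carrier ?A"
    then show "\<exists>s\<in>carrier ?A. s \<oplus>\<^bsub>?A\<^esub> p = \<zero>\<^bsub>?A\<^esub>"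
      by (intro bexI[of _ "- p"]) auto
  qed (use keys_add in \<open>auto simp: add_ac\<close>)
  moreover have "monoid ?A"
    using closed by (intro monoidI) (auto simp: assoc l_one r_one)
  ultimately have "ring ?A"
    by (rule ringI) (auto simp: distribs)
  moreover have "Poly_Mapping.map ((*) (c + d)) p = Poly_Mapping.map ((*) c) p + Poly_Mapping.map ((*) d) p"
    "Poly_Mapping.map ((*) c) (Poly_Mapping.map ((*) d) p) = Poly_Mapping.map ((*) (c * d)) p"
    "Poly_Mapping.map ((*) 1) p = p"
    for c d :: 'k and p :: "'a \<Rightarrow>\<^sub>0 'k"
    by (rule poly_mapping_eqI; simp add: lookup_add algebra_simps)+
  moreover have "Poly_Mapping.keys (Poly_Mapping.map ((*) c) p) \<subseteq> carrier G"
    if "Poly_Mapping.keys p \<subseteq> carrier G" for c and p :: "'a \<Rightarrow>\<^sub>0 'k"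
    using that by (rule order.trans[OF keys_scale_subset])
  ultimately show ?thesis
    by (intro k_algebra.intro k_algebra_axioms.intro) (auto simp: smult_left smult_right)
qed

lemma single_carrier [simp]:
  "u \<in> carrier G \<Longrightarrow> Poly_Mapping.single u c \<in> carrier (monoid_algebra G)"
  by simp

section \<open>Linear extension from a monoid to its monoid algebra\<close>

context k_algebra begin

lemma lin_ext_superset:
  assumes "finite S" "Poly_Mapping.keys p \<subseteq> S" "f \<in> S \<rightarrow> carrier A"
  shows "lin_ext A f p = (\<Oplus>w\<in>S. Poly_Mapping.lookup p w \<odot> f w)"
  unfolding lin_ext_def using assms
  by (intro add.finprod_mono_neutral_cong_left) (auto simp: in_keys_iff Pi_iff)

lemma lin_ext_zero [simp]: "lin_ext A f 0 = \<zero>"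
  by (simp add: lin_ext_def)

lemma lin_ext_single [simp]:
  "f u \<in> carrier A \<Longrightarrow> lin_ext A f (Poly_Mapping.single u c) = c \<odot> f u"
  using lin_ext_superset[of "{u}" "Poly_Mapping.single u c" f] by simp

lemma lin_ext_linear:
  assumes f: "f \<in> carrier G \<rightarrow> carrier A"
  shows "linear_map (monoid_algebra G) A (lin_ext A f)"
proof (rule linear_mapI)
  fix p :: "_ \<Rightarrow>\<^sub>0 'k" assume "p \<in> carrier (monoid_algebra G)"
  then show "lin_ext A f p \<in> carrier A"
    using f by (auto simp: lin_ext_def intro!: finsum_closed)
next
  fix p s :: "_ \<Rightarrow>\<^sub>0 'k" assume ps: "p \<in> carrier (monoid_algebra G)" "s \<in> carrier (monoid_algebra G)"
  let ?S = "Poly_Mapping.keys p \<union> Poly_Mapping.keys s"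
  have S: "f \<in> ?S \<rightarrow> carrier A" using ps f by auto
  have "lin_ext A f (p + s) = (\<Oplus>w\<in>?S. Poly_Mapping.lookup (p + s) w \<odot> f w)"
    using Poly_Mapping.keys_add[of p s] S by (intro lin_ext_superset) auto
  also have "\<dots> = (\<Oplus>w\<in>?S. Poly_Mapping.lookup p w \<odot> f w \<oplus> Poly_Mapping.lookup s w \<odot> f w)"
    using S by (intro finsum_cong') (auto simp: lookup_add smult_l_distr Pi_iff)
  also have "\<dots> = (\<Oplus>w\<in>?S. Poly_Mapping.lookup p w \<odot> f w) \<oplus> (\<Oplus>w\<in>?S. Poly_Mapping.lookup s w \<odot> f w)"
    using S by (intro finsum_addf) auto
  also have "\<dots> = lin_ext A f p \<oplus> lin_ext A f s"
    using S by (simp add: lin_ext_superset[where S = ?S])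
  finally show "lin_ext A f (p \<oplus>\<^bsub>monoid_algebra G\<^esub> s) = lin_ext A f p \<oplus> lin_ext A f s" by simp
next
  fix p :: "_ \<Rightarrow>\<^sub>0 'k" and c assume p: "p \<in> carrier (monoid_algebra G)"
  let ?S = "Poly_Mapping.keys p"
  have S: "f \<in> ?S \<rightarrow> carrier A" using p f by auto
  have "lin_ext A f (Poly_Mapping.map ((*) c) p) =
      (\<Oplus>w\<in>?S. Poly_Mapping.lookup (Poly_Mapping.map ((*) c) p) w \<odot> f w)"
    using S keys_scale_subset[of c p] by (intro lin_ext_superset) auto
  also have "\<dots> = (\<Oplus>w\<in>?S. c \<odot> (Poly_Mapping.lookup p w \<odot> f w))"
    using S by (intro finsum_cong') (auto simp: smult_smult Pi_iff)
  also have "\<dots> = c \<odot> lin_ext A f p"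
    using S by (subst lin_ext_superset[OF _ _ S]) (auto simp: smult_finsum Pi_iff)
  finally show "lin_ext A f (c \<odot>\<^bsub>monoid_algebra G\<^esub> p) = c \<odot> lin_ext A f p" by simp
qed

text \<open>The universal property of the monoid algebra. Multiplicativity is additive in each
  factor, which again leaves only one-point functions.\<close>

lemma lin_ext_algebra_hom:
  assumes f: "f \<in> carrier G \<rightarrow> carrier A" and G: "monoid G"
    and mult: "\<And>u v. u \<in> carrier G \<Longrightarrow> v \<in> carrier G \<Longrightarrow> f (u \<otimes>\<^bsub>G\<^esub> v) = f u \<otimes> f v"
    and one: "f \<one>\<^bsub>G\<^esub> = \<one>"
  shows "algebra_hom (monoid_algebra G) A (lin_ext A f)"
proof (rule algebra_homI)
  interpret G: monoid G by (rule G)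
  interpret B: k_algebra "monoid_algebra G :: ('k, _ \<Rightarrow>\<^sub>0 'k) module"
    by (rule k_algebra_monoid_algebra[OF G])
  note lin = lin_ext_linear[OF f]
  note closed = linear_map_closed[OF lin, simplified]
  note add = linear_map_add[OF lin, simplified]
  show "linear_map (monoid_algebra G) A (lin_ext A f)" by (rule lin)
  fix p s :: "_ \<Rightarrow>\<^sub>0 'k"
  assume p: "p \<in> carrier (monoid_algebra G)" and s: "s \<in> carrier (monoid_algebra G)"
  from p have "Poly_Mapping.keys p \<subseteq> carrier G" by simp
  then show "lin_ext A f (p \<otimes>\<^bsub>monoid_algebra G\<^esub> s) = lin_ext A f p \<otimes> lin_ext A f s"
  proof (induction p rule: poly_mapping_carrier_induct)
    case (add p p')
    have "Poly_Mapping.keys (p \<otimes>\<^bsub>monoid_algebra G\<^esub> s) \<subseteq> carrier G"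
      "Poly_Mapping.keys (p' \<otimes>\<^bsub>monoid_algebra G\<^esub> s) \<subseteq> carrier G"
      using add.hyps s B.m_closed[of p s] B.m_closed[of p' s] by auto
    then show ?case
      using add s by (simp add: monoid_algebra_mult_add_left \<open>\<And>a b. _ \<Longrightarrow> _ \<Longrightarrow> lin_ext A f (a + b) = _\<close> closed l_distr)
  next
    case (single u c)
    from s have "Poly_Mapping.keys s \<subseteq> carrier G" by simp
    then show ?case
    proof (induction s rule: poly_mapping_carrier_induct)
      case (add p p')
      have "Poly_Mapping.keys (Poly_Mapping.single u c \<otimes>\<^bsub>monoid_algebra G\<^esub> p) \<subseteq> carrier G"
        "Poly_Mapping.keys (Poly_Mapping.single u c \<otimes>\<^bsub>monoid_algebra G\<^esub> p') \<subseteq> carrier G"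
        using add.hyps single B.m_closed[of "Poly_Mapping.single u c" p]
          B.m_closed[of "Poly_Mapping.single u c" p'] by auto
      moreover have "lin_ext A f (Poly_Mapping.single u c) \<in> carrier A"
        using single by (intro closed) auto
      ultimately show ?case
        using add single by (simp add: monoid_algebra_mult_add_right \<open>\<And>a b. _ \<Longrightarrow> _ \<Longrightarrow> lin_ext A f (a + b) = _\<close> closed r_distr)
    next
      case zero
      show ?case using single f by (auto simp: Pi_iff)
    next
      case (single v d)
      then show ?case using \<open>u \<in> carrier G\<close> f
        by (auto simp: mult Pi_iff smult_mult_left smult_mult_right smult_smult mult.commute)
    qed
  next
    case zero
    show ?case using s by (auto simp: closed)
  qed
next
  show "lin_ext A f \<one>\<^bsub>monoid_algebra G\<^esub> = \<one>" using one by simp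
qed

end

section \<open>Quotients of an algebra by an ideal\<close>

lemma quotient_algebra_simps [simp]:
  "mult (quotient_algebra A I) = rcoset_mult A I"
  "one (quotient_algebra A I) = I +>\<^bsub>A\<^esub> \<one>\<^bsub>A\<^esub>"
  "zero (quotient_algebra A I) = I"
  "add (quotient_algebra A I) = set_add A"
  "smult (quotient_algebra A I) = (\<lambda>c C. \<Union>a\<in>C. I +>\<^bsub>A\<^esub> (c \<odot>\<^bsub>A\<^esub> a))"
  by (simp_all add: quotient_algebra_def FactRing_def)

lemma carrier_quotient_algebra: "carrier (quotient_algebra A I) = (\<lambda>a. I +>\<^bsub>A\<^esub> a) ` carrier A"
  by (auto simp: quotient_algebra_def FactRing_simps)

context
  fixes A :: "('k::field, 'a, 'm) module_scheme" and I
  assumes A: "k_algebra A" and I: "ideal I A"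
begin

interpretation A: k_algebra A by (rule A)
interpretation I: ideal I A by (rule I)

text \<open>Scaling by \<open>c\<close> is left multiplication by \<open>c\<close> times the unit,
  so a ring ideal is automatically a linear subspace.\<close>

lemma ideal_smult_closed: "h \<in> I \<Longrightarrow> c \<odot>\<^bsub>A\<^esub> h \<in> I"
  using I.I_l_closed[of h "c \<odot>\<^bsub>A\<^esub> \<one>\<^bsub>A\<^esub>"] I.a_Hcarr by (simp add: A.smult_mult_left)

text \<open>The scalar multiple of a class is a union over all representatives. The cosets in that
  union coincide, because two representatives differ by an element of \<open>I\<close> and
  \<open>I\<close> is closed under scalars.\<close>

lemma quotient_smult:
  assumes a: "a \<in> carrier A"
  shows "c \<odot>\<^bsub>quotient_algebra A I\<^esub> (I +>\<^bsub>A\<^esub> a) = I +>\<^bsub>A\<^esub> (c \<odot>\<^bsub>A\<^esub> a)"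
proof -
  have "I +>\<^bsub>A\<^esub> (c \<odot>\<^bsub>A\<^esub> b) = I +>\<^bsub>A\<^esub> (c \<odot>\<^bsub>A\<^esub> a)" if "b \<in> I +>\<^bsub>A\<^esub> a" for b
  proof -
    from that obtain h where h: "h \<in> I" "b = h \<oplus>\<^bsub>A\<^esub> a"
      by (auto simp: a_r_coset_def r_coset_def)
    have "c \<odot>\<^bsub>A\<^esub> b \<in> I +>\<^bsub>A\<^esub> (c \<odot>\<^bsub>A\<^esub> a)"
      using h a ideal_smult_closed[of h c]
      by (auto simp: a_r_coset_def r_coset_def A.smult_r_distr I.a_Hcarr)
    then show ?thesis
      using a by (metis I.a_repr_independence' A.smult_closed)
  qed
  then have "(\<Union>b\<in>I +>\<^bsub>A\<^esub> a. I +>\<^bsub>A\<^esub> (c \<odot>\<^bsub>A\<^esub> b)) = (\<Union>b\<in>I +>\<^bsub>A\<^esub> a. I +>\<^bsub>A\<^esub> (c \<odot>\<^bsub>A\<^esub> a))"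
    by (rule SUP_cong[OF refl])
  then show ?thesis
    using I.a_rcos_self[OF a] by auto
qed

lemma k_algebra_quotient: "k_algebra (quotient_algebra A I)"
  by (rule k_algebra_image[OF A, where \<pi> = "\<lambda>a. I +>\<^bsub>A\<^esub> a"])
    (simp_all add: carrier_quotient_algebra I.a_rcos_sum I.rcoset_mult_add quotient_smult
      del: quotient_algebra_simps(5) add: I.a_rcos_const)

lemma quotient_proj_algebra_hom: "algebra_hom A (quotient_algebra A I) (\<lambda>a. I +>\<^bsub>A\<^esub> a)"
  by (intro algebra_homI linear_mapI)
    (auto simp add: carrier_quotient_algebra I.a_rcos_sum I.rcoset_mult_add quotient_smult
      simp del: quotient_algebra_simps(5))

lemma quotient_proj_zero: "a \<in> I \<Longrightarrow> I +>\<^bsub>A\<^esub> a = \<zero>\<^bsub>quotient_algebra A I\<^esub>"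
  by (simp add: I.a_rcos_const)

text \<open>A map that kills \<open>I\<close> is constant on each coset, so its image of a coset is
  a singleton. This justifies \<open>the_elem\<close> in \<open>induced\<close>.\<close>

lemma quotient_map_the_elem:
  assumes B: "k_algebra B" and h: "linear_map A B h" and kills: "\<And>a. a \<in> I \<Longrightarrow> h a = \<zero>\<^bsub>B\<^esub>"
    and a: "a \<in> carrier A"
  shows "the_elem (h ` (I +>\<^bsub>A\<^esub> a)) = h a"
proof -
  interpret B: k_algebra B by (rule B)
  have "h b = h a" if "b \<in> I +>\<^bsub>A\<^esub> a" for b
    using that a kills I.a_Hcarr linear_map_add[OF h] linear_map_closed[OF h]
    by (auto simp: a_r_coset_def r_coset_def)
  then have "h ` (I +>\<^bsub>A\<^esub> a) = (\<lambda>_. h a) ` (I +>\<^bsub>A\<^esub> a)"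
    by (rule image_cong[OF refl])
  also have "\<dots> = {h a}"
    using I.a_rcos_self[OF a] by auto
  finally show ?thesis by simp
qed

lemma quotient_map_linear:
  assumes B: "k_algebra B" and h: "linear_map A B h" and kills: "\<And>a. a \<in> I \<Longrightarrow> h a = \<zero>\<^bsub>B\<^esub>"
  shows "linear_map (quotient_algebra A I) B (\<lambda>C. the_elem (h ` C))"
proof (rule linear_mapI)
  note the_elem = quotient_map_the_elem[OF B h kills]
  note hom = quotient_proj_algebra_hom[THEN algebra_hom_linear]
  fix C assume "C \<in> carrier (quotient_algebra A I)"
  then obtain a where a: "a \<in> carrier A" "C = I +>\<^bsub>A\<^esub> a"
    by (auto simp: carrier_quotient_algebra)
  then show "the_elem (h ` C) \<in> carrier B"
    by (auto simp: the_elem linear_map_closed[OF h])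
  show "the_elem (h ` (c \<odot>\<^bsub>quotient_algebra A I\<^esub> C)) = c \<odot>\<^bsub>B\<^esub> the_elem (h ` C)" for c
    using a by (simp add: the_elem quotient_smult linear_map_smult[OF h] del: quotient_algebra_simps)
  fix D assume "D \<in> carrier (quotient_algebra A I)"
  then obtain b where b: "b \<in> carrier A" "D = I +>\<^bsub>A\<^esub> b"
    by (auto simp: carrier_quotient_algebra)
  show "the_elem (h ` (C \<oplus>\<^bsub>quotient_algebra A I\<^esub> D)) = the_elem (h ` C) \<oplus>\<^bsub>B\<^esub> the_elem (h ` D)"
    using a b by (simp add: the_elem I.a_rcos_sum linear_map_add[OF h])
qed

lemma quotient_map_algebra_hom:
  assumes B: "k_algebra B" and h: "algebra_hom A B h" and kills: "\<And>a. a \<in> I \<Longrightarrow> h a = \<zero>\<^bsub>B\<^esub>"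
  shows "algebra_hom (quotient_algebra A I) B (\<lambda>C. the_elem (h ` C))"
proof (rule algebra_homI)
  note lin = algebra_hom_linear[OF h]
  note the_elem = quotient_map_the_elem[OF B lin kills]
  show "linear_map (quotient_algebra A I) B (\<lambda>C. the_elem (h ` C))"
    by (rule quotient_map_linear[OF B lin kills])
  show "the_elem (h ` \<one>\<^bsub>quotient_algebra A I\<^esub>) = \<one>\<^bsub>B\<^esub>"
    by (simp add: the_elem algebra_hom_one[OF h])
  fix C D assume "C \<in> carrier (quotient_algebra A I)" "D \<in> carrier (quotient_algebra A I)"
  then obtain a b where "a \<in> carrier A" "C = I +>\<^bsub>A\<^esub> a" "b \<in> carrier A" "D = I +>\<^bsub>A\<^esub> b"
    by (auto simp: carrier_quotient_algebra)
  then show "the_elem (h ` (C \<otimes>\<^bsub>quotient_algebra A I\<^esub> D)) = the_elem (h ` C) \<otimes>\<^bsub>B\<^esub> the_elem (h ` D)"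
    by (simp add: the_elem I.rcoset_mult_add algebra_hom_mult[OF h])
qed

end

lemma monoid_algebra_minus:
  fixes p s :: "'a \<Rightarrow>\<^sub>0 'k::field"
  assumes "monoid G" "p \<in> carrier (monoid_algebra G)" "s \<in> carrier (monoid_algebra G)"
  shows "p \<ominus>\<^bsub>monoid_algebra G\<^esub> s = p - s"
proof -
  interpret A: k_algebra "monoid_algebra G :: ('k, 'a \<Rightarrow>\<^sub>0 'k) module"
    by (rule k_algebra_monoid_algebra[OF assms(1)])
  have "\<ominus>\<^bsub>monoid_algebra G\<^esub> s = - s"
    using assms(2,3) by (intro A.minus_equality) auto
  then show ?thesis
    by (simp add: a_minus_def)
qed

lemma monoid_algebra_mult_diff:
  "p \<otimes>\<^bsub>monoid_algebra G\<^esub> (s - t) = p \<otimes>\<^bsub>monoid_algebra G\<^esub> s - p \<otimes>\<^bsub>monoid_algebra G\<^esub> t"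
  "(s - t) \<otimes>\<^bsub>monoid_algebra G\<^esub> p = s \<otimes>\<^bsub>monoid_algebra G\<^esub> p - t \<otimes>\<^bsub>monoid_algebra G\<^esub> p"
  using monoid_algebra_mult_add_right[where p = p and s = "s - t" and s' = t and G = G]
    monoid_algebra_mult_add_left[where p = "s - t" and p' = t and s = p and G = G]
  by (simp_all add: algebra_simps)

lemma scale_diff [simp]:
  "Poly_Mapping.map ((*) (c::'k::field)) (p - s) =
    Poly_Mapping.map ((*) c) p - Poly_Mapping.map ((*) c) s"
  by (rule poly_mapping_eqI) (auto simp: lookup_minus algebra_simps)

section \<open>Tensor powers\<close>

definition multilinear_on ::
    "('k::field, 'a, 'm) module_scheme \<Rightarrow> nat \<Rightarrow> ('k, 'b, 'n) module_scheme \<Rightarrow> ('a list \<Rightarrow> 'b) \<Rightarrow> bool" where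
  "multilinear_on H m B f \<longleftrightarrow> f \<in> carrier (symbol_monoid H m) \<rightarrow> carrier B \<and>
     (\<forall>w\<in>carrier (symbol_monoid H m). \<forall>i<m. linear_map H B (\<lambda>a. f (w[i := a])))"

lemma symbol_monoid_simps [simp]:
  "carrier (symbol_monoid H m) = {w. length w = m \<and> set w \<subseteq> carrier H}"
  "mult (symbol_monoid H m) = map2 (mult H)"
  "one (symbol_monoid H m) = replicate m \<one>\<^bsub>H\<^esub>"
  by (simp_all add: symbol_monoid_def)

lemma map2_list_update_right:
  "length u = length w \<Longrightarrow> i < length w \<Longrightarrow> map2 f u (w[i := a]) = (map2 f u w)[i := f (u ! i) a]"
  by (rule nth_equalityI) (auto simp: nth_list_update)

lemma map2_list_update_left:
  "length u = length w \<Longrightarrow> i < length w \<Longrightarrow> map2 f (w[i := a]) u = (map2 f w u)[i := f a (u ! i)]"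
  by (rule nth_equalityI) (auto simp: nth_list_update)

context k_algebra begin

lemma map2_mult_closed:
  "length u = length v \<Longrightarrow> set u \<subseteq> carrier A \<Longrightarrow> set v \<subseteq> carrier A \<Longrightarrow> set (map2 (\<otimes>) u v) \<subseteq> carrier A"
  by (induction u v rule: list_induct2) auto

lemma monoid_symbol_monoid: "monoid (symbol_monoid A m)"
proof (rule monoidI)
  fix u v w
  assume "u \<in> carrier (symbol_monoid A m)" "v \<in> carrier (symbol_monoid A m)"
    "w \<in> carrier (symbol_monoid A m)"
  then show "u \<otimes>\<^bsub>symbol_monoid A m\<^esub> v \<otimes>\<^bsub>symbol_monoid A m\<^esub> w =
      u \<otimes>\<^bsub>symbol_monoid A m\<^esub> (v \<otimes>\<^bsub>symbol_monoid A m\<^esub> w)"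
    by (intro nth_equalityI) (auto simp: m_assoc subset_iff)
next
  fix u assume u: "u \<in> carrier (symbol_monoid A m)"
  then show "\<one>\<^bsub>symbol_monoid A m\<^esub> \<otimes>\<^bsub>symbol_monoid A m\<^esub> u = u"
    "u \<otimes>\<^bsub>symbol_monoid A m\<^esub> \<one>\<^bsub>symbol_monoid A m\<^esub> = u"
    by (auto intro!: nth_equalityI simp: subset_iff)
qed (use map2_mult_closed in auto)

abbreviation symbols :: "nat \<Rightarrow> ('k, 'a list \<Rightarrow>\<^sub>0 'k) module" where
  "symbols m \<equiv> monoid_algebra (symbol_monoid A m)"

lemma k_algebra_symbols: "k_algebra (symbols m)"
  by (rule k_algebra_monoid_algebra[OF monoid_symbol_monoid])

lemma set_list_update_subset: "set w \<subseteq> S \<Longrightarrow> a \<in> S \<Longrightarrow> set (w[i := a]) \<subseteq> S"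
  using set_update_subset_insert[of w i a] by blast

lemma multilinear_relsE:
  assumes "p \<in> multilinear_rels A m"
  obtains (sum) w i a b where
      "p = Poly_Mapping.single (w[i := a \<oplus> b]) 1 - Poly_Mapping.single (w[i := a]) 1
        - Poly_Mapping.single (w[i := b]) 1"
      "length w = m" "set w \<subseteq> carrier A" "i < m" "a \<in> carrier A" "b \<in> carrier A"
    | (scale) w i a c where
      "p = Poly_Mapping.single (w[i := c \<odot> a]) 1 - Poly_Mapping.single (w[i := a]) c"
      "length w = m" "set w \<subseteq> carrier A" "i < m" "a \<in> carrier A"
  using assms unfolding multilinear_rels_def symbol_monoid_simps by blast

lemma symbols_diff_closed:
  assumes "p \<in> carrier (symbols m)" "s \<in> carrier (symbols m)"
  shows "p - s \<in> carrier (symbols m)"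
proof -
  interpret S: k_algebra "symbols m" by (rule k_algebra_symbols)
  show ?thesis
    using S.minus_closed[OF assms] monoid_algebra_minus[OF monoid_symbol_monoid assms] by simp
qed

lemma single_list_update_closed:
  "length w = m \<Longrightarrow> set w \<subseteq> carrier A \<Longrightarrow> a \<in> carrier A \<Longrightarrow>
    Poly_Mapping.single (w[i := a]) c \<in> carrier (symbols m)"
  by (intro single_carrier) (simp add: set_list_update_subset)

lemma multilinear_rels_subset: "multilinear_rels A m \<subseteq> carrier (symbols m)"
proof
  fix p assume "p \<in> multilinear_rels A m"
  then show "p \<in> carrier (symbols m)"
    by (cases rule: multilinear_relsE)
      (simp_all only: symbols_diff_closed single_list_update_closed a_closed smult_closed)
qed

lemma tensor_null_subspace: "linear_subspace (symbols m) (tensor_null A m)"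
  unfolding tensor_null_def
  by (rule linear_subspace_linear_span[OF k_algebra_symbols multilinear_rels_subset])

lemma multilinear_rels_sum:
  assumes "length w = m" "set w \<subseteq> carrier A" "i < m" "a \<in> carrier A" "b \<in> carrier A"
  shows "Poly_Mapping.single (w[i := a \<oplus> b]) 1 - Poly_Mapping.single (w[i := a]) 1
    - Poly_Mapping.single (w[i := b]) 1 \<in> multilinear_rels A m"
  unfolding multilinear_rels_def using assms by (intro UnI1) auto

lemma multilinear_rels_scale:
  assumes "length w = m" "set w \<subseteq> carrier A" "i < m" "a \<in> carrier A"
  shows "Poly_Mapping.single (w[i := c \<odot> a]) 1 - Poly_Mapping.single (w[i := a]) c
    \<in> multilinear_rels A m"
  unfolding multilinear_rels_def using assms by (intro UnI2) auto

text \<open>Componentwise multiplication by a symbol \<open>u\<close> turns a multilinearity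
  relation in slot \<open>i\<close> into the relation of the same kind in slot \<open>i\<close>,
  with the varying entry multiplied by \<open>u ! i\<close>; the coefficient \<open>c\<close> only
  rescales it.\<close>

lemma tensor_null_single_mult:
  assumes u: "length u = m" "set u \<subseteq> carrier A" and p: "p \<in> multilinear_rels A m"
  shows "Poly_Mapping.single u c \<otimes>\<^bsub>symbols m\<^esub> p \<in> tensor_null A m"
    and "p \<otimes>\<^bsub>symbols m\<^esub> Poly_Mapping.single u c \<in> tensor_null A m"
proof -
  have rels: "Poly_Mapping.map ((*) c) s \<in> tensor_null A m" if "s \<in> multilinear_rels A m" for s
    using that linear_span_superset[of "multilinear_rels A m" "symbols m"]
      linear_subspace_smult[OF tensor_null_subspace, of s m c]
    by (auto simp: tensor_null_def)
  have ui: "u ! i \<in> carrier A" if "i < m" for i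
    using u that by (auto simp: subset_iff)
  from p have "Poly_Mapping.single u c \<otimes>\<^bsub>symbols m\<^esub> p \<in> tensor_null A m \<and>
    p \<otimes>\<^bsub>symbols m\<^esub> Poly_Mapping.single u c \<in> tensor_null A m"
  proof (cases rule: multilinear_relsE)
    case (sum w i a b)
    have uw: "set (map2 (\<otimes>) u w) \<subseteq> carrier A" "set (map2 (\<otimes>) w u) \<subseteq> carrier A"
      using u sum map2_mult_closed by auto
    show ?thesis
      using rels[OF multilinear_rels_sum[of "map2 (\<otimes>) u w" m i "u ! i \<otimes> a" "u ! i \<otimes> b"]]
        rels[OF multilinear_rels_sum[of "map2 (\<otimes>) w u" m i "a \<otimes> u ! i" "b \<otimes> u ! i"]]
        u sum uw ui
      by (simp add: monoid_algebra_mult_diff map2_list_update_right map2_list_update_left l_distr r_distr)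
  next
    case (scale w i a d)
    have uw: "set (map2 (\<otimes>) u w) \<subseteq> carrier A" "set (map2 (\<otimes>) w u) \<subseteq> carrier A"
      using u scale map2_mult_closed by auto
    show ?thesis
      using rels[OF multilinear_rels_scale[of "map2 (\<otimes>) u w" m i "u ! i \<otimes> a" d]]
        rels[OF multilinear_rels_scale[of "map2 (\<otimes>) w u" m i "a \<otimes> u ! i" d]]
        u scale uw ui
      by (simp add: monoid_algebra_mult_diff map2_list_update_right map2_list_update_left
          smult_mult_left smult_mult_right mult.commute)
  qed
  then show "Poly_Mapping.single u c \<otimes>\<^bsub>symbols m\<^esub> p \<in> tensor_null A m"
    and "p \<otimes>\<^bsub>symbols m\<^esub> Poly_Mapping.single u c \<in> tensor_null A m"
    by auto
qed

lemma tensor_null_ideal: "ideal (tensor_null A m) (symbols m)"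
proof -
  interpret S: k_algebra "symbols m" by (rule k_algebra_symbols)
  note N = tensor_null_subspace[of m]
  \<comment> \<open>\<open>?W\<close> collects the elements whose products from either side are
    null. It is a subspace, so it contains the whole span once it contains the relations.\<close>
  let ?W = "{p \<in> carrier (symbols m). \<forall>s\<in>carrier (symbols m).
    s \<otimes>\<^bsub>symbols m\<^esub> p \<in> tensor_null A m \<and> p \<otimes>\<^bsub>symbols m\<^esub> s \<in> tensor_null A m}"
  have "linear_subspace (symbols m) ?W"
    by (rule linear_subspaceI[OF k_algebra_symbols])
      (auto simp del: monoid_algebra_simps simp: S.l_distr S.r_distr S.smult_mult_left S.smult_mult_right
        intro: linear_subspace_add[OF N] linear_subspace_smult[OF N] linear_subspace_zero[OF N])
  moreover have "multilinear_rels A m \<subseteq> ?W"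
  proof
    fix p assume p: "p \<in> multilinear_rels A m"
    have "s \<otimes>\<^bsub>symbols m\<^esub> p \<in> tensor_null A m \<and> p \<otimes>\<^bsub>symbols m\<^esub> s \<in> tensor_null A m"
      if "Poly_Mapping.keys s \<subseteq> carrier (symbol_monoid A m)" for s
      using that
      by (induction s rule: poly_mapping_carrier_induct)
        (use linear_subspace_add[OF N] linear_subspace_zero[OF N] tensor_null_single_mult[OF _ _ p] in
          \<open>auto simp: monoid_algebra_mult_add_left monoid_algebra_mult_add_right\<close>)
    then have "\<forall>s\<in>carrier (symbols m). s \<otimes>\<^bsub>symbols m\<^esub> p \<in> tensor_null A m \<and>
        p \<otimes>\<^bsub>symbols m\<^esub> s \<in> tensor_null A m"
      by simp
    then show "p \<in> ?W"
      using p multilinear_rels_subset[of m] by blast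
  qed
  ultimately have "tensor_null A m \<subseteq> ?W"
    unfolding tensor_null_def by (rule linear_span_least)
  moreover have "additive_subgroup (tensor_null A m) (symbols m)"
    using N by (simp add: linear_subspace_def)
  ultimately show ?thesis
    by (intro idealI S.ring_axioms) (auto simp: additive_subgroup_def)
qed

lemma k_algebra_tensor_power: "k_algebra (tensor_power A m)"
  unfolding tensor_power_def by (rule k_algebra_quotient[OF k_algebra_symbols tensor_null_ideal])

lemma tensor_proj_hom:
  "algebra_hom (symbols m) (tensor_power A m) (\<lambda>p. tensor_null A m +>\<^bsub>symbols m\<^esub> p)"
  unfolding tensor_power_def by (rule quotient_proj_algebra_hom[OF k_algebra_symbols tensor_null_ideal])

lemma tensor_power_carrierE:
  assumes "X \<in> carrier (tensor_power A m)"
  obtains p where "p \<in> carrier (symbols m)" "X = tensor_null A m +>\<^bsub>symbols m\<^esub> p"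
  using assms by (auto simp: tensor_power_def carrier_quotient_algebra)

lemma pure_tensor_closed:
  "length w = m \<Longrightarrow> set w \<subseteq> carrier A \<Longrightarrow> pure_tensor A w \<in> carrier (tensor_power A m)"
  by (auto simp: pure_tensor_def tensor_power_def carrier_quotient_algebra)

lemma pure_tensor_mult:
  assumes "length u = m" "set u \<subseteq> carrier A" "length v = m" "set v \<subseteq> carrier A"
  shows "pure_tensor A u \<otimes>\<^bsub>tensor_power A m\<^esub> pure_tensor A v = pure_tensor A (map2 (\<otimes>) u v)"
  using algebra_hom_mult[OF tensor_proj_hom, of "Poly_Mapping.single u 1" m "Poly_Mapping.single v 1"] assms
  by (simp add: pure_tensor_def)

lemma pure_tensor_one: "\<one>\<^bsub>tensor_power A m\<^esub> = pure_tensor A (replicate m \<one>)"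
  using algebra_hom_one[OF tensor_proj_hom, of m] by (simp add: pure_tensor_def)

lemma tensor_null_coset_eq:
  assumes "p \<in> carrier (symbols m)" "s \<in> carrier (symbols m)" "p - s \<in> multilinear_rels A m"
  shows "tensor_null A m +>\<^bsub>symbols m\<^esub> p = tensor_null A m +>\<^bsub>symbols m\<^esub> s"
proof -
  interpret I: ideal "tensor_null A m" "symbols m" by (rule tensor_null_ideal)
  have "p - s \<in> tensor_null A m"
    unfolding tensor_null_def by (rule subsetD[OF linear_span_superset assms(3)])
  then have "(p - s) \<oplus>\<^bsub>symbols m\<^esub> s \<in> tensor_null A m +>\<^bsub>symbols m\<^esub> s"
    using I.a_subset assms(2) by (rule I.a_rcosI)
  then have "p \<in> tensor_null A m +>\<^bsub>symbols m\<^esub> s"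
    by simp
  then show ?thesis
    using assms(2) by (rule I.a_repr_independence'[symmetric])
qed

text \<open>The relations divided out are exactly the differences between the two sides of
  additivity and homogeneity in a slot, so both sides have the same coset.\<close>

lemma pure_tensor_multilinear: "multilinear_on A m (tensor_power A m) (pure_tensor A)"
  unfolding multilinear_on_def
proof (intro conjI ballI allI impI)
  show "pure_tensor A \<in> carrier (symbol_monoid A m) \<rightarrow> carrier (tensor_power A m)"
    by (auto intro: pure_tensor_closed)
  note lin = algebra_hom_linear[OF tensor_proj_hom[of m]]
  fix w i assume w: "w \<in> carrier (symbol_monoid A m)" and i: "i < m"
  then have w': "set (w[i := a]) \<subseteq> carrier A" if "a \<in> carrier A" for a
    using that by (simp add: set_list_update_subset)
  show "linear_map A (tensor_power A m) (\<lambda>a. pure_tensor A (w[i := a]))"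
  proof (rule linear_mapI)
    fix a assume a: "a \<in> carrier A"
    then show "pure_tensor A (w[i := a]) \<in> carrier (tensor_power A m)"
      using w w' by (intro pure_tensor_closed) auto
    fix c
    have "tensor_null A m +>\<^bsub>symbols m\<^esub> Poly_Mapping.single (w[i := c \<odot> a]) 1 =
        tensor_null A m +>\<^bsub>symbols m\<^esub> Poly_Mapping.single (w[i := a]) c"
      by (rule tensor_null_coset_eq) (use w i a w' multilinear_rels_scale in auto)
    also have "\<dots> = c \<odot>\<^bsub>tensor_power A m\<^esub> (tensor_null A m +>\<^bsub>symbols m\<^esub> Poly_Mapping.single (w[i := a]) 1)"
      using linear_map_smult[OF lin, of "Poly_Mapping.single (w[i := a]) 1" c] w w' a by simp
    finally show "pure_tensor A (w[i := c \<odot> a]) = c \<odot>\<^bsub>tensor_power A m\<^esub> pure_tensor A (w[i := a])"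
      using w by (simp add: pure_tensor_def)
  next
    fix a b assume a: "a \<in> carrier A" "b \<in> carrier A"
    have keys: "Poly_Mapping.keys (Poly_Mapping.single (w[i := a]) 1 + Poly_Mapping.single (w[i := b]) (1::'k))
        \<subseteq> {w. length w = m \<and> set w \<subseteq> carrier A}"
      by (rule order.trans[OF Poly_Mapping.keys_add]) (use a w w' in auto)
    have "tensor_null A m +>\<^bsub>symbols m\<^esub> Poly_Mapping.single (w[i := a \<oplus> b]) 1 =
        tensor_null A m +>\<^bsub>symbols m\<^esub> (Poly_Mapping.single (w[i := a]) 1 + Poly_Mapping.single (w[i := b]) 1)"
      by (rule tensor_null_coset_eq)
        (use w i a w' keys multilinear_rels_sum[of w m i a b] in \<open>auto simp: algebra_simps\<close>)
    also have "\<dots> = (tensor_null A m +>\<^bsub>symbols m\<^esub> Poly_Mapping.single (w[i := a]) 1) \<oplus>\<^bsub>tensor_power A m\<^esub>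
        (tensor_null A m +>\<^bsub>symbols m\<^esub> Poly_Mapping.single (w[i := b]) 1)"
      using linear_map_add[OF lin, of "Poly_Mapping.single (w[i := a]) 1" "Poly_Mapping.single (w[i := b]) 1"]
        w w' a by simp
    finally show "pure_tensor A (w[i := a \<oplus> b]) =
        pure_tensor A (w[i := a]) \<oplus>\<^bsub>tensor_power A m\<^esub> pure_tensor A (w[i := b])"
      using w by (simp add: pure_tensor_def)
  qed
qed

text \<open>Pure tensors span the tensor power; this is the uniqueness half of its universal
  property.\<close>

lemma tensor_linear_map_eqI:
  assumes B: "k_algebra B" and h: "linear_map (tensor_power A m) B h" "linear_map (tensor_power A m) B k"
    and eq: "\<And>w. length w = m \<Longrightarrow> set w \<subseteq> carrier A \<Longrightarrow> h (pure_tensor A w) = k (pure_tensor A w)"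
    and X: "X \<in> carrier (tensor_power A m)"
  shows "h X = k X"
proof -
  interpret S: k_algebra "symbols m" by (rule k_algebra_symbols)
  from X obtain p where p: "p \<in> carrier (symbols m)" and X: "X = tensor_null A m +>\<^bsub>symbols m\<^esub> p"
    by (rule tensor_power_carrierE)
  note lin = linear_map_comp[OF algebra_hom_linear[OF tensor_proj_hom]]
  note hl = lin[OF h(1)] and kl = lin[OF h(2)]
  from p have "Poly_Mapping.keys p \<subseteq> carrier (symbol_monoid A m)" by simp
  then show ?thesis
    unfolding X
  proof (induction p rule: poly_mapping_carrier_induct)
    case zero
    then show ?case
      using linear_map_zero[OF k_algebra_symbols B hl] linear_map_zero[OF k_algebra_symbols B kl] by simp
  next
    case (add p s)
    then show ?case
      using linear_map_add[OF hl, of p s] linear_map_add[OF kl, of p s] by simp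
  next
    case (single u c)
    then show ?case
      using linear_map_smult[OF hl, of "Poly_Mapping.single u 1" c]
        linear_map_smult[OF kl, of "Poly_Mapping.single u 1" c] eq[of u]
      by (simp add: pure_tensor_def)
  qed
qed

section \<open>Existence half of the universal property of the tensor power\<close>

context
  fixes B :: "('k, 'b, 'n) module_scheme" and m f
  assumes B: "k_algebra B" and f: "multilinear_on A m B f"
begin

interpretation B: k_algebra B by (rule B)

lemma multilinear_closed: "length w = m \<Longrightarrow> set w \<subseteq> carrier A \<Longrightarrow> f w \<in> carrier B"
  using f by (auto simp: multilinear_on_def)

lemma lin_ext_multilinear: "linear_map (symbols m) B (lin_ext B f)"
  by (rule B.lin_ext_linear) (auto simp: multilinear_closed)

lemma lin_ext_tensor_null:
  assumes "p \<in> tensor_null A m"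
  shows "lin_ext B f p = \<zero>\<^bsub>B\<^esub>"
proof -
  have minus: "lin_ext B f (p - s) = lin_ext B f p \<ominus>\<^bsub>B\<^esub> lin_ext B f s \<and> p - s \<in> carrier (symbols m)"
    if "p \<in> carrier (symbols m)" "s \<in> carrier (symbols m)" for p s
    using linear_map_minus[OF k_algebra_symbols B lin_ext_multilinear that]
      monoid_algebra_minus[OF monoid_symbol_monoid that]
      abelian_group.minus_closed[OF ring.is_abelian_group[OF k_algebra.axioms(1)[OF k_algebra_symbols]] that]
    by simp
  have lin: "linear_map A B (\<lambda>a. f (w[i := a]))"
    if "length w = m" "set w \<subseteq> carrier A" "i < m" for w i
    using that f by (auto simp: multilinear_on_def)
  \<comment> \<open>The kernel of the linear extension is a subspace, so it is enough that it
    contains the generating relations.\<close>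
  have "multilinear_rels A m \<subseteq> {p \<in> carrier (symbols m). lin_ext B f p = \<zero>\<^bsub>B\<^esub>}"
  proof
    fix p assume p: "p \<in> multilinear_rels A m"
    then show "p \<in> {p \<in> carrier (symbols m). lin_ext B f p = \<zero>\<^bsub>B\<^esub>}"
    proof (cases rule: multilinear_relsE)
      case (sum w i a b)
      have upd: "w[i := a'] \<in> carrier (symbol_monoid A m)" "f (w[i := a']) \<in> carrier B" if "a' \<in> carrier A" for a'
        using that sum by (auto simp: set_list_update_subset multilinear_closed)
      have "lin_ext B f p = f (w[i := a \<oplus> b]) \<ominus>\<^bsub>B\<^esub> f (w[i := a]) \<ominus>\<^bsub>B\<^esub> f (w[i := b])"
        using sum upd by (simp add: minus single_carrier del: monoid_algebra_simps symbol_monoid_simps)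
      also have "\<dots> = \<zero>\<^bsub>B\<^esub>"
        using upd sum by (simp add: linear_map_add[OF lin] B.add_minus_minus)
      finally show ?thesis using p multilinear_rels_subset by auto
    next
      case (scale w i a d)
      have upd: "w[i := a'] \<in> carrier (symbol_monoid A m)" "f (w[i := a']) \<in> carrier B" if "a' \<in> carrier A" for a'
        using that scale by (auto simp: set_list_update_subset multilinear_closed)
      have "lin_ext B f p = f (w[i := d \<odot> a]) \<ominus>\<^bsub>B\<^esub> d \<odot>\<^bsub>B\<^esub> f (w[i := a])"
        using scale upd by (simp add: minus single_carrier del: monoid_algebra_simps symbol_monoid_simps)
      also have "\<dots> = \<zero>\<^bsub>B\<^esub>"
        using upd scale by (simp add: linear_map_smult[OF lin] B.minus_eq B.r_neg)
      finally show ?thesis using p multilinear_rels_subset by auto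
    qed
  qed
  then have "tensor_null A m \<subseteq> {p \<in> carrier (symbols m). lin_ext B f p = \<zero>\<^bsub>B\<^esub>}"
    unfolding tensor_null_def
    by (rule linear_span_least[OF kernel_linear_subspace[OF k_algebra_symbols B lin_ext_multilinear]])
  then show ?thesis using assms by blast
qed

lemma induced_multilinear: "linear_map (tensor_power A m) B (induced B f)"
  unfolding induced_def tensor_power_def
  by (rule quotient_map_linear[OF k_algebra_symbols tensor_null_ideal B lin_ext_multilinear])
    (rule lin_ext_tensor_null)

lemma induced_pure_tensor:
  assumes "length w = m" "set w \<subseteq> carrier A"
  shows "induced B f (pure_tensor A w) = f w"
  using quotient_map_the_elem[OF k_algebra_symbols tensor_null_ideal B lin_ext_multilinear,
      of "Poly_Mapping.single w 1"] lin_ext_tensor_null assms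
  by (simp add: induced_def pure_tensor_def multilinear_closed)

lemma induced_algebra_hom:
  assumes mult: "\<And>u v. length u = m \<Longrightarrow> set u \<subseteq> carrier A \<Longrightarrow> length v = m \<Longrightarrow> set v \<subseteq> carrier A \<Longrightarrow>
      f (map2 (\<otimes>) u v) = f u \<otimes>\<^bsub>B\<^esub> f v"
    and one: "f (replicate m \<one>) = \<one>\<^bsub>B\<^esub>"
  shows "algebra_hom (tensor_power A m) B (induced B f)"
proof -
  have "algebra_hom (symbols m) B (lin_ext B f)"
    by (rule B.lin_ext_algebra_hom[OF _ monoid_symbol_monoid])
      (auto simp: multilinear_closed mult one)
  then show ?thesis
    unfolding induced_def tensor_power_def
    by (rule quotient_map_algebra_hom[OF k_algebra_symbols tensor_null_ideal B])
      (rule lin_ext_tensor_null)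
qed

end

end

section \<open>Tensors with two and three factors and the leg maps\<close>

context k_algebra begin

lemma length2E:
  assumes "length w = 2" "set w \<subseteq> carrier A"
  obtains a b where "w = [a, b]" "a \<in> carrier A" "b \<in> carrier A"
  using assms by (auto simp: numeral_2_eq_2 length_Suc_conv)

lemma multilinear_on_2I:
  assumes "\<And>a b. a \<in> carrier A \<Longrightarrow> b \<in> carrier A \<Longrightarrow> f [a, b] \<in> carrier B"
    and "\<And>b. b \<in> carrier A \<Longrightarrow> linear_map A B (\<lambda>a. f [a, b])"
    and "\<And>a. a \<in> carrier A \<Longrightarrow> linear_map A B (\<lambda>b. f [a, b])"
  shows "multilinear_on A 2 B f"
  unfolding multilinear_on_def symbol_monoid_simps
proof (intro conjI funcsetI ballI allI impI; elim CollectE conjE)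
  fix w i assume w: "length w = 2" "set w \<subseteq> carrier A" and i: "i < (2::nat)"
  from w obtain a b where "w = [a, b]" "a \<in> carrier A" "b \<in> carrier A" by (rule length2E)
  moreover from i have "i = 0 \<or> i = 1" by auto
  ultimately show "linear_map A B (\<lambda>a. f (w[i := a]))"
    using assms by auto
next
  fix w assume "length w = 2" "set w \<subseteq> carrier A"
  then show "f w \<in> carrier B" using assms(1) by (metis length2E)
qed

lemma pure_tensor_linear:
  assumes "length w = m" "set w \<subseteq> carrier A" "i < m"
  shows "linear_map A (tensor_power A m) (\<lambda>a. pure_tensor A (w[i := a]))"
  using pure_tensor_multilinear[of m] assms by (auto simp: multilinear_on_def)

lemma pure_tensor_linear2:
  assumes "c \<in> carrier A"
  shows "linear_map A (tensor_power A 2) (\<lambda>a. pure_tensor A [a, c])"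
    and "linear_map A (tensor_power A 2) (\<lambda>a. pure_tensor A [c, a])"
  using assms pure_tensor_linear[of "[c, c]" 2 0] pure_tensor_linear[of "[c, c]" 2 1] by simp_all

lemma pure_tensor_linear3:
  assumes "c \<in> carrier A" "d \<in> carrier A"
  shows "linear_map A (tensor_power A 3) (\<lambda>a. pure_tensor A [a, c, d])"
    and "linear_map A (tensor_power A 3) (\<lambda>a. pure_tensor A [c, a, d])"
    and "linear_map A (tensor_power A 3) (\<lambda>a. pure_tensor A [c, d, a])"
  using assms pure_tensor_linear[of "[c, c, d]" 3 0] pure_tensor_linear[of "[c, c, d]" 3 1]
    pure_tensor_linear[of "[c, d, d]" 3 2]
  by simp_all

lemma tensor2_linear_map_eqI:
  assumes "k_algebra B" "linear_map (tensor_power A 2) B h" "linear_map (tensor_power A 2) B k"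
    and eq: "\<And>a b. a \<in> carrier A \<Longrightarrow> b \<in> carrier A \<Longrightarrow> h (pure_tensor A [a, b]) = k (pure_tensor A [a, b])"
    and "X \<in> carrier (tensor_power A 2)"
  shows "h X = k X"
  using assms(1,2,3) _ assms(5)
  by (rule tensor_linear_map_eqI) (erule (1) length2E, simp add: eq)

lemma leg12_multilinear:
  "multilinear_on A 2 (tensor_power A 3) (\<lambda>w. pure_tensor A [w ! 0, w ! 1, \<one>])"
  by (rule multilinear_on_2I) (auto intro!: pure_tensor_linear3 pure_tensor_closed)

lemma leg13_multilinear:
  "multilinear_on A 2 (tensor_power A 3) (\<lambda>w. pure_tensor A [w ! 0, \<one>, w ! 1])"
  by (rule multilinear_on_2I) (auto intro!: pure_tensor_linear3 pure_tensor_closed)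

lemma leg12_pure:
  "a \<in> carrier A \<Longrightarrow> b \<in> carrier A \<Longrightarrow> leg12 A (pure_tensor A [a, b]) = pure_tensor A [a, b, \<one>]"
  unfolding leg12_def by (subst induced_pure_tensor[OF k_algebra_tensor_power leg12_multilinear]) auto

lemma leg13_pure:
  "a \<in> carrier A \<Longrightarrow> b \<in> carrier A \<Longrightarrow> leg13 A (pure_tensor A [a, b]) = pure_tensor A [a, \<one>, b]"
  unfolding leg13_def by (subst induced_pure_tensor[OF k_algebra_tensor_power leg13_multilinear]) auto

text \<open>Multiplicativity is needed so that the image of the invertible element \<open>R\<close>
  is again invertible in the third tensor power.\<close>

lemma leg12_algebra_hom: "algebra_hom (tensor_power A 2) (tensor_power A 3) (leg12 A)"
  unfolding leg12_def
proof (rule induced_algebra_hom[OF k_algebra_tensor_power leg12_multilinear])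
  fix u v assume "length u = 2" "set u \<subseteq> carrier A" "length v = 2" "set v \<subseteq> carrier A"
  then show "pure_tensor A [map2 (\<otimes>) u v ! 0, map2 (\<otimes>) u v ! 1, \<one>] =
      pure_tensor A [u ! 0, u ! 1, \<one>] \<otimes>\<^bsub>tensor_power A 3\<^esub> pure_tensor A [v ! 0, v ! 1, \<one>]"
    by (auto elim!: length2E simp: pure_tensor_mult)
qed (simp add: pure_tensor_one numeral_3_eq_3)

lemma leg13_linear: "linear_map (tensor_power A 2) (tensor_power A 3) (leg13 A)"
  unfolding leg13_def by (rule induced_multilinear[OF k_algebra_tensor_power leg13_multilinear])

lemma cons_multilinear:
  assumes "a \<in> carrier A"
  shows "multilinear_on A m (tensor_power A (Suc m)) (\<lambda>v. pure_tensor A (a # v))"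
  unfolding multilinear_on_def symbol_monoid_simps
proof (intro conjI funcsetI ballI allI impI; elim CollectE conjE)
  fix w i assume w: "length w = m" "set w \<subseteq> carrier A" and i: "i < m"
  then show "linear_map A (tensor_power A (Suc m)) (\<lambda>b. pure_tensor A (a # w[i := b]))"
    using pure_tensor_linear[of "a # w" "Suc m" "Suc i"] assms by simp
qed (use assms in \<open>auto intro!: pure_tensor_closed\<close>)

text \<open>\<open>id_comult\<close> nests one \<open>induced\<close> inside another, and this is
  the linearity of the outer symbol in its first slot. There \<open>X\<close> will be a value of the
  comultiplication, which need not be a pure tensor, so each identity in \<open>a\<close> is proved
  by comparing two linear maps in \<open>X\<close>.\<close>

lemma cons_linear:
  assumes "X \<in> carrier (tensor_power A 2)"
  shows "linear_map A (tensor_power A 3) (\<lambda>a. induced (tensor_power A 3) (\<lambda>v. pure_tensor A (a # v)) X)"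
proof (rule linear_mapI)
  note T3 = k_algebra_tensor_power[of 3]
  have multi: "multilinear_on A 2 (tensor_power A 3) (\<lambda>v. pure_tensor A (a # v))"
    if "a \<in> carrier A" for a
    using cons_multilinear[OF that, of 2] by (simp add: numeral_3_eq_3)
  note lin = induced_multilinear[OF T3 multi]
  note pure = induced_pure_tensor[OF T3 multi]
  fix a assume a: "a \<in> carrier A"
  show "induced (tensor_power A 3) (\<lambda>v. pure_tensor A (a # v)) X \<in> carrier (tensor_power A 3)"
    using linear_map_closed[OF lin[OF a] assms] .
  show "induced (tensor_power A 3) (\<lambda>v. pure_tensor A ((c \<odot> a) # v)) X =
      c \<odot>\<^bsub>tensor_power A 3\<^esub> induced (tensor_power A 3) (\<lambda>v. pure_tensor A (a # v)) X" for c
    by (rule tensor2_linear_map_eqI[OF T3 lin linear_map_scale[OF T3 lin] _ assms])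
      (use a in \<open>simp_all add: pure linear_map_smult[OF pure_tensor_linear3(1)]\<close>)
  fix b assume b: "b \<in> carrier A"
  show "induced (tensor_power A 3) (\<lambda>v. pure_tensor A ((a \<oplus> b) # v)) X =
      induced (tensor_power A 3) (\<lambda>v. pure_tensor A (a # v)) X \<oplus>\<^bsub>tensor_power A 3\<^esub>
      induced (tensor_power A 3) (\<lambda>v. pure_tensor A (b # v)) X"
    by (rule tensor2_linear_map_eqI[OF T3 lin linear_map_sum[OF T3 lin lin] _ assms])
      (use a b in \<open>simp_all add: pure linear_map_add[OF pure_tensor_linear3(1)]\<close>)
qed

end

section \<open>Characters of tensor powers: the functionals \<phi>_1 \<otimes> ... \<otimes>
  \<phi>_m\<close>

definition tensor_functional ::
    "('k::field, 'a, 'm) module_scheme \<Rightarrow> ('a \<Rightarrow> 'k) list \<Rightarrow> ('a list \<Rightarrow>\<^sub>0 'k) set \<Rightarrow> 'k" where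
  "tensor_functional H \<phi>s = induced ground_algebra (\<lambda>w. \<Prod>i<length \<phi>s. (\<phi>s ! i) (w ! i))"

context k_algebra begin

context
  fixes \<phi>s :: "('a \<Rightarrow> 'k) list"
  assumes \<phi>s: "\<And>\<phi>. \<phi> \<in> set \<phi>s \<Longrightarrow> algebra_hom A ground_algebra \<phi>"
begin

lemma nth_character: "i < length \<phi>s \<Longrightarrow> algebra_hom A ground_algebra (\<phi>s ! i)"
  using \<phi>s by simp

lemma character_product_multilinear:
  "multilinear_on A (length \<phi>s) (ground_algebra :: ('k, 'k) module) (\<lambda>w. \<Prod>i<length \<phi>s. (\<phi>s ! i) (w ! i))"
  unfolding multilinear_on_def symbol_monoid_simps
proof (intro conjI funcsetI ballI allI impI; elim CollectE conjE)
  fix w :: "'a list" and j assume w: "length w = length \<phi>s" and j: "j < length \<phi>s"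
  \<comment> \<open>With the other slots frozen, their factors form a constant and only the
    \<open>j\<close>-th character varies.\<close>
  let ?c = "\<Prod>i\<in>{..<length \<phi>s} - {j}. (\<phi>s ! i) (w ! i)"
  have "(\<Prod>i<length \<phi>s. (\<phi>s ! i) (w[j := a] ! i)) = ?c * (\<phi>s ! j) a" for a
  proof -
    have "(\<Prod>i\<in>{..<length \<phi>s} - {j}. (\<phi>s ! i) (w[j := a] ! i)) = ?c"
      by (rule prod.cong) auto
    then show ?thesis
      using w j by (simp add: prod.remove[of "{..<length \<phi>s}" j])
  qed
  moreover have "linear_map A (ground_algebra :: ('k, 'k) module) (\<lambda>a. ?c * (\<phi>s ! j) a)"
    using linear_map_scale[OF k_algebra_ground algebra_hom_linear[OF nth_character[OF j]], of ?c] by simp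
  ultimately show "linear_map A ground_algebra (\<lambda>a. \<Prod>i<length \<phi>s. (\<phi>s ! i) (w[j := a] ! i))"
    by simp
qed simp

text \<open>Products of characters are again characters because the field is commutative: the
  factors of the two products can be regrouped slot by slot.\<close>

lemma tensor_functional_algebra_hom:
  "algebra_hom (tensor_power A (length \<phi>s)) ground_algebra (tensor_functional A \<phi>s)"
  unfolding tensor_functional_def
proof (rule induced_algebra_hom[OF k_algebra_ground character_product_multilinear])
  show "(\<Prod>i<length \<phi>s. (\<phi>s ! i) (replicate (length \<phi>s) \<one> ! i)) = \<one>\<^bsub>ground_algebra\<^esub>"
    using algebra_hom_one[OF nth_character] by simp
  fix u v assume u: "length u = length \<phi>s" "set u \<subseteq> carrier A" and v: "length v = length \<phi>s" "set v \<subseteq> carrier A"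
  have "(\<Prod>i<length \<phi>s. (\<phi>s ! i) (map2 (\<otimes>) u v ! i)) =
      (\<Prod>i<length \<phi>s. (\<phi>s ! i) (u ! i) * (\<phi>s ! i) (v ! i))"
    using u v algebra_hom_mult[OF nth_character] by (intro prod.cong) (auto simp: subset_iff)
  then show "(\<Prod>i<length \<phi>s. (\<phi>s ! i) (map2 (\<otimes>) u v ! i)) =
      (\<Prod>i<length \<phi>s. (\<phi>s ! i) (u ! i)) \<otimes>\<^bsub>ground_algebra\<^esub> (\<Prod>i<length \<phi>s. (\<phi>s ! i) (v ! i))"
    by (simp add: prod.distrib)
qed

lemma tensor_functional_pure:
  "length w = length \<phi>s \<Longrightarrow> set w \<subseteq> carrier A \<Longrightarrow>
    tensor_functional A \<phi>s (pure_tensor A w) = (\<Prod>i<length \<phi>s. (\<phi>s ! i) (w ! i))"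
  unfolding tensor_functional_def
  by (rule induced_pure_tensor[OF k_algebra_ground character_product_multilinear])

end

lemma tensor_functional2:
  assumes "algebra_hom A ground_algebra \<phi>" "algebra_hom A ground_algebra \<psi>"
  shows "algebra_hom (tensor_power A 2) ground_algebra (tensor_functional A [\<phi>, \<psi>])"
    and "a \<in> carrier A \<Longrightarrow> b \<in> carrier A \<Longrightarrow>
      tensor_functional A [\<phi>, \<psi>] (pure_tensor A [a, b]) = \<phi> a * \<psi> b"
  using tensor_functional_algebra_hom[of "[\<phi>, \<psi>]"] tensor_functional_pure[of "[\<phi>, \<psi>]" "[a, b]"] assms
  by (auto simp: numeral_2_eq_2 lessThan_Suc mult_ac)

lemma tensor_functional3:
  assumes "algebra_hom A ground_algebra \<phi>" "algebra_hom A ground_algebra \<psi>"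
    "algebra_hom A ground_algebra \<theta>"
  shows "algebra_hom (tensor_power A 3) ground_algebra (tensor_functional A [\<phi>, \<psi>, \<theta>])"
    and "a \<in> carrier A \<Longrightarrow> b \<in> carrier A \<Longrightarrow> c \<in> carrier A \<Longrightarrow>
      tensor_functional A [\<phi>, \<psi>, \<theta>] (pure_tensor A [a, b, c]) = \<phi> a * \<psi> b * \<theta> c"
  using tensor_functional_algebra_hom[of "[\<phi>, \<psi>, \<theta>]"]
    tensor_functional_pure[of "[\<phi>, \<psi>, \<theta>]" "[a, b, c]"] assms
  by (auto simp: numeral_3_eq_3 lessThan_Suc mult_ac)

end

section \<open>The comultiplication in the second factor and its behaviour under characters\<close>

lemma
  fixes H :: "('k::field, 'a, 'm) bialgebra_scheme"
  assumes H: "k_algebra H" and \<Delta>: "linear_map H (tensor_power H 2) (comult H)"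
  shows id_comult_linear: "linear_map (tensor_power H 2) (tensor_power H 3) (id_comult H)"
    and id_comult_pure: "\<And>a b. a \<in> carrier H \<Longrightarrow> b \<in> carrier H \<Longrightarrow>
      id_comult H (pure_tensor H [a, b]) = induced (tensor_power H 3) (\<lambda>v. pure_tensor H (a # v)) (comult H b)"
proof -
  interpret H: k_algebra H by (rule H)
  note T3 = H.k_algebra_tensor_power[of 3]
  have lin: "linear_map (tensor_power H 2) (tensor_power H 3)
      (induced (tensor_power H 3) (\<lambda>v. pure_tensor H (a # v)))" if "a \<in> carrier H" for a
    using H.induced_multilinear[OF T3, of 2] H.cons_multilinear[OF that, of 2] by (simp add: numeral_3_eq_3)
  have multi: "multilinear_on H 2 (tensor_power H 3)
     (\<lambda>w. induced (tensor_power H 3) (\<lambda>v. pure_tensor H (w ! 0 # v)) (comult H (w ! 1)))"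
    using linear_map_comp[OF \<Delta> lin] H.cons_linear linear_map_closed[OF \<Delta>] linear_map_closed[OF lin]
    by (intro H.multilinear_on_2I) auto
  show "linear_map (tensor_power H 2) (tensor_power H 3) (id_comult H)"
    unfolding id_comult_def by (rule H.induced_multilinear[OF T3 multi])
  show "id_comult H (pure_tensor H [a, b]) =
      induced (tensor_power H 3) (\<lambda>v. pure_tensor H (a # v)) (comult H b)"
    if "a \<in> carrier H" "b \<in> carrier H" for a b
    unfolding id_comult_def using that by (subst H.induced_pure_tensor[OF T3 multi]) auto
qed

text \<open>A character takes the value 1 on the inserted unit, which removes one slot from each
  leg. In the third part \<zeta> is the convolution product of \<psi> and \<theta>, so two
  characters applied after the comultiplication merge into one.\<close>

lemma tensor_functional_legs:
  fixes H :: "('k::field, 'a, 'm) bialgebra_scheme"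
  assumes H: "k_algebra H" and \<Delta>: "linear_map H (tensor_power H 2) (comult H)"
    and \<phi>: "algebra_hom H ground_algebra \<phi>" and \<psi>: "algebra_hom H ground_algebra \<psi>"
    and \<theta>: "algebra_hom H ground_algebra \<theta>" and X: "X \<in> carrier (tensor_power H 2)"
  shows "tensor_functional H [\<phi>, \<psi>, \<theta>] (leg12 H X) = tensor_functional H [\<phi>, \<psi>] X" (is ?leg12)
    and "tensor_functional H [\<phi>, \<psi>, \<theta>] (leg13 H X) = tensor_functional H [\<phi>, \<theta>] X" (is ?leg13)
    and "\<lbrakk>\<And>h. h \<in> carrier H \<Longrightarrow> tensor_functional H [\<psi>, \<theta>] (comult H h) = \<zeta> h;
        algebra_hom H ground_algebra \<zeta>\<rbrakk> \<Longrightarrow>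
      tensor_functional H [\<phi>, \<psi>, \<theta>] (id_comult H X) = tensor_functional H [\<phi>, \<zeta>] X"
proof -
  interpret H: k_algebra H by (rule H)
  note T3 = H.k_algebra_tensor_power[of 3]
  note f3 = H.tensor_functional3[OF \<phi> \<psi> \<theta>]
  note lin = linear_map_comp[OF _ algebra_hom_linear[OF f3(1)]]
  note eqI = H.tensor2_linear_map_eqI[OF k_algebra_ground lin algebra_hom_linear[OF H.tensor_functional2(1)] _ X]
  show ?leg12
    by (rule eqI[OF algebra_hom_linear[OF H.leg12_algebra_hom] \<phi> \<psi>])
      (simp add: H.leg12_pure f3 H.tensor_functional2[OF \<phi> \<psi>] algebra_hom_one[OF \<theta>, simplified])
  show ?leg13
    by (rule eqI[OF H.leg13_linear \<phi> \<theta>])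
      (simp add: H.leg13_pure f3 H.tensor_functional2[OF \<phi> \<theta>] algebra_hom_one[OF \<psi>, simplified])
  assume \<zeta>: "\<And>h. h \<in> carrier H \<Longrightarrow> tensor_functional H [\<psi>, \<theta>] (comult H h) = \<zeta> h"
    and \<zeta>_hom: "algebra_hom H ground_algebra \<zeta>"
  have cons: "multilinear_on H 2 (tensor_power H 3) (\<lambda>v. pure_tensor H (a # v))"
    if "a \<in> carrier H" for a
    using H.cons_multilinear[OF that, of 2] by (simp add: numeral_3_eq_3)
  \<comment> \<open>The tensor \<open>Y\<close> stands for a value of the comultiplication, so the
    factorization is extended linearly from pure tensors \<open>[b, c]\<close>.\<close>
  have "tensor_functional H [\<phi>, \<psi>, \<theta>] (induced (tensor_power H 3) (\<lambda>v. pure_tensor H (a # v)) Y) =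
      \<phi> a * tensor_functional H [\<psi>, \<theta>] Y"
    if a: "a \<in> carrier H" and Y: "Y \<in> carrier (tensor_power H 2)" for a Y
  proof (rule H.tensor2_linear_map_eqI[OF k_algebra_ground _ _ _ Y])
    show "linear_map (tensor_power H 2) ground_algebra
      (\<lambda>Y. tensor_functional H [\<phi>, \<psi>, \<theta>] (induced (tensor_power H 3) (\<lambda>v. pure_tensor H (a # v)) Y))"
      by (rule lin[OF H.induced_multilinear[OF T3 cons[OF a]]])
    show "linear_map (tensor_power H 2) ground_algebra (\<lambda>Y. \<phi> a * tensor_functional H [\<psi>, \<theta>] Y)"
      using linear_map_scale[OF k_algebra_ground algebra_hom_linear[OF H.tensor_functional2(1)[OF \<psi> \<theta>]], of "\<phi> a"]
      by simp
    show "tensor_functional H [\<phi>, \<psi>, \<theta>]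
        (induced (tensor_power H 3) (\<lambda>v. pure_tensor H (a # v)) (pure_tensor H [b, c])) =
      \<phi> a * tensor_functional H [\<psi>, \<theta>] (pure_tensor H [b, c])"
      if "b \<in> carrier H" "c \<in> carrier H" for b c
      using that a by (simp add: H.induced_pure_tensor[OF T3 cons] f3 H.tensor_functional2[OF \<psi> \<theta>])
  qed
  then show "tensor_functional H [\<phi>, \<psi>, \<theta>] (id_comult H X) = tensor_functional H [\<phi>, \<zeta>] X"
    by (intro eqI[OF id_comult_linear[OF H \<Delta>] \<phi> \<zeta>_hom])
      (simp add: id_comult_pure[OF H \<Delta>] linear_map_closed[OF \<Delta>] \<zeta> H.tensor_functional2[OF \<phi> \<zeta>_hom])
qed

section \<open>The quantum binomial formula\<close>

text \<open>The Gaussian binomial coefficients at \<open>p\<close>. The Pascal recursion involves no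
  division, so they make sense at roots of unity, where the usual quotient of factorials can have a
  zero denominator.\<close>

fun qbinomial :: "'k::field \<Rightarrow> nat \<Rightarrow> nat \<Rightarrow> 'k" where
  "qbinomial p m 0 = 1"
| "qbinomial p 0 (Suc k) = 0"
| "qbinomial p (Suc m) (Suc k) = p ^ Suc k * qbinomial p m (Suc k) + qbinomial p m k"

lemma qbinomial_eq_0: "m < k \<Longrightarrow> qbinomial p m k = 0"
proof (induction m arbitrary: k)
  case 0 then show ?case by (cases k) auto
next
  case (Suc m) then show ?case by (cases k) auto
qed

lemma qbinomial_self: "qbinomial p m m = 1"
  by (induction m) (simp_all add: qbinomial_eq_0)

text \<open>The quotient of neighbouring coefficients with denominators cleared. Writing the upper
  index as \<open>k + j\<close> avoids truncated subtraction. The recursion and the two smaller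
  instances bring both sides to the common form
  \<open>(1 - p ^ Suc (k + i)) * qbinomial p (k + i) k\<close>, where
  \<open>j = Suc i\<close>.\<close>

lemma qbinomial_ratio: "(1 - p ^ Suc k) * qbinomial p (k + j) (Suc k) = (1 - p ^ j) * qbinomial p (k + j) k"
proof (induction "k + j" arbitrary: k j)
  case 0
  then show ?case by simp
next
  case (Suc m)
  show ?case
  proof (cases j)
    case 0
    then show ?thesis by (simp add: qbinomial_eq_0)
  next
    case j: (Suc i)
    with Suc.hyps(2) have m: "m = k + i" by simp
    have IH: "(1 - p ^ Suc k) * qbinomial p (k + i) (Suc k) = (1 - p ^ i) * qbinomial p (k + i) k"
      by (rule Suc.hyps(1)) (use m in auto)
    have L: "(1 - p ^ Suc k) * qbinomial p (k + j) (Suc k) = (1 - p ^ Suc (k + i)) * qbinomial p (k + i) k"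
    proof -
      have "(1 - p ^ Suc k) * qbinomial p (k + j) (Suc k) =
          p ^ Suc k * ((1 - p ^ Suc k) * qbinomial p (k + i) (Suc k)) + (1 - p ^ Suc k) * qbinomial p (k + i) k"
        by (simp add: j algebra_simps)
      also have "\<dots> = (1 - p ^ Suc (k + i)) * qbinomial p (k + i) k"
        unfolding IH by (simp add: algebra_simps power_add)
      finally show ?thesis .
    qed
    show ?thesis
    proof (cases k)
      case 0
      with L show ?thesis by (simp add: j)
    next
      case k: (Suc l)
      have IH': "(1 - p ^ Suc l) * qbinomial p (l + j) (Suc l) = (1 - p ^ j) * qbinomial p (l + j) l"
        by (rule Suc.hyps(1)) (use m j k in auto)
      have "(1 - p ^ j) * qbinomial p (k + j) k =
          p ^ k * (1 - p ^ j) * qbinomial p (l + j) k + (1 - p ^ j) * qbinomial p (l + j) l"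
        by (simp add: k algebra_simps)
      also have "\<dots> = (1 - p ^ Suc (k + i)) * qbinomial p (k + i) k"
        unfolding IH'[symmetric] by (simp add: k j algebra_simps power_add)
      finally show ?thesis using L by simp
    qed
  qed
qed

text \<open>By the ratio identity the vanishing spreads from k to k + 1: it starts with the factor 1
  - p^n = 0, and the factor 1 - p^(k+1) on the left can be cancelled because \<open>p\<close> is
  primitive and k + 1 < n.\<close>

lemma qbinomial_root_of_unity:
  assumes "primitive_root_of_unity n p" "0 < k" "k < n"
  shows "qbinomial p n k = 0"
  using assms(2,3)
proof (induction k)
  case (Suc k)
  have "(1 - p ^ Suc k) * qbinomial p n (Suc k) = (1 - p ^ (n - k)) * qbinomial p n k"
    using qbinomial_ratio[of p k "n - k"] Suc.prems by simp
  also have "\<dots> = 0"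
  proof (cases k)
    case 0
    then show ?thesis using assms(1) by (simp add: primitive_root_of_unity_def)
  qed (use Suc in auto)
  finally show ?case
    using assms(1) Suc.prems unfolding primitive_root_of_unity_def
    by (metis eq_iff_diff_eq_0 mult_eq_0_iff zero_less_Suc)
qed auto

context k_algebra begin

lemma qcommute_pow:
  assumes "u \<in> carrier A" "v \<in> carrier A" "u \<otimes> v = p \<odot> (v \<otimes> u)"
  shows "u \<otimes> v [^] (k::nat) = p ^ k \<odot> (v [^] k \<otimes> u)"
proof (induction k)
  case (Suc k)
  have "u \<otimes> v [^] Suc k = (u \<otimes> v [^] k) \<otimes> v"
    using assms by (simp add: m_assoc)
  also have "\<dots> = p ^ k \<odot> (v [^] k \<otimes> (u \<otimes> v))"
    using assms(1,2) Suc by (simp add: smult_mult_left m_assoc)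
  also have "\<dots> = p ^ Suc k \<odot> (v [^] Suc k \<otimes> u)"
    using assms by (simp add: smult_mult_right smult_smult m_assoc mult.commute)
  finally show ?case .
qed (use assms in simp)

text \<open>Induction with left multiplication by \<open>u \<oplus> v\<close>: moving
  \<open>u\<close> past v^k costs p^k, while \<open>v\<close> raises k by one. These two
  contributions are the two terms of the Pascal recursion, which fixes the order \<open>v\<close>
  before \<open>u\<close> in each term.\<close>

lemma quantum_binomial:
  assumes u: "u \<in> carrier A" and v: "v \<in> carrier A" and uv: "u \<otimes> v = p \<odot> (v \<otimes> u)"
  shows "(u \<oplus> v) [^] (m::nat) = (\<Oplus>k\<in>{..m}. qbinomial p m k \<odot> (v [^] k \<otimes> u [^] (m - k)))"
proof (induction m)
  case 0
  show ?case using u v by simp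
next
  case (Suc m)
  let ?t = "\<lambda>m k. v [^] (k::nat) \<otimes> u [^] (m - k :: nat)"
  have t: "?t m k \<in> carrier A" for m k using u v by simp
  have ut: "u \<otimes> ?t m k = p ^ k \<odot> ?t (Suc m) k" if "k \<le> m" for k
  proof -
    have "u \<otimes> ?t m k = (u \<otimes> v [^] k) \<otimes> u [^] (m - k)"
      using u v by (simp add: m_assoc)
    also have "\<dots> = p ^ k \<odot> (v [^] k \<otimes> (u \<otimes> u [^] (m - k)))"
      using u v by (simp add: qcommute_pow[OF u v uv] smult_mult_left m_assoc)
    also have "u \<otimes> u [^] (m - k) = u [^] (Suc m - k)"
      using u that by (metis Suc_diff_le nat_pow_Suc2)
    finally show ?thesis .
  qed
  have vt: "v \<otimes> ?t m k = ?t (Suc m) (Suc k)" for k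
    using u v by (metis diff_Suc_Suc m_assoc nat_pow_Suc2 nat_pow_closed)
  have rcomm: "a \<oplus> b \<oplus> c = a \<oplus> c \<oplus> b"
    if "a \<in> carrier A" "b \<in> carrier A" "c \<in> carrier A" for a b c
    using that by (simp add: a_ac)
  have "(u \<oplus> v) [^] Suc m = (u \<oplus> v) \<otimes> (\<Oplus>k\<in>{..m}. qbinomial p m k \<odot> ?t m k)"
    unfolding Suc[symmetric] using u v by (intro nat_pow_Suc2) auto
  also have "\<dots> = (\<Oplus>k\<in>{..m}. u \<otimes> (qbinomial p m k \<odot> ?t m k)) \<oplus>
      (\<Oplus>k\<in>{..m}. v \<otimes> (qbinomial p m k \<odot> ?t m k))"
    using u v t by (simp add: l_distr finsum_rdistr Pi_iff)
  also have "(\<Oplus>k\<in>{..m}. u \<otimes> (qbinomial p m k \<odot> ?t m k)) =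
      (\<Oplus>k\<in>{..m}. (p ^ k * qbinomial p m k) \<odot> ?t (Suc m) k)"
    using u v t by (intro finsum_cong') (auto simp: smult_mult_right ut smult_smult mult.commute)
  \<comment> \<open>The added term has coefficient \<open>qbinomial p m (Suc m) = 0\<close>.
    Splitting off the term at 0 afterwards aligns this sum with the shifted one.\<close>
  also have "\<dots> = (\<Oplus>k\<in>{..Suc m}. (p ^ k * qbinomial p m k) \<odot> ?t (Suc m) k)"
    using u v t by (simp add: qbinomial_eq_0 Pi_iff)
  also have "\<dots> = (\<Oplus>k\<in>{..m}. (p ^ Suc k * qbinomial p m (Suc k)) \<odot> ?t (Suc m) (Suc k)) \<oplus> ?t (Suc m) 0"
    using u v t by (subst finsum_Suc2) (auto simp: Pi_iff)
  also have "(\<Oplus>k\<in>{..m}. v \<otimes> (qbinomial p m k \<odot> ?t m k)) =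
      (\<Oplus>k\<in>{..m}. qbinomial p m k \<odot> ?t (Suc m) (Suc k))"
    using u v t by (intro finsum_cong') (auto simp: smult_mult_right vt simp del: nat_pow_Suc)
  also have "(\<Oplus>k\<in>{..m}. (p ^ Suc k * qbinomial p m (Suc k)) \<odot> ?t (Suc m) (Suc k)) \<oplus> ?t (Suc m) 0 \<oplus>
      (\<Oplus>k\<in>{..m}. qbinomial p m k \<odot> ?t (Suc m) (Suc k)) =
      ((\<Oplus>k\<in>{..m}. (p ^ Suc k * qbinomial p m (Suc k)) \<odot> ?t (Suc m) (Suc k)) \<oplus>
      (\<Oplus>k\<in>{..m}. qbinomial p m k \<odot> ?t (Suc m) (Suc k))) \<oplus> ?t (Suc m) 0"
    using u v t by (intro rcomm finsum_closed) (auto simp: Pi_iff)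
  also have "(\<Oplus>k\<in>{..m}. (p ^ Suc k * qbinomial p m (Suc k)) \<odot> ?t (Suc m) (Suc k)) \<oplus>
      (\<Oplus>k\<in>{..m}. qbinomial p m k \<odot> ?t (Suc m) (Suc k)) =
      (\<Oplus>k\<in>{..m}. qbinomial p (Suc m) (Suc k) \<odot> ?t (Suc m) (Suc k))"
    using u v t by (subst finsum_addf[symmetric]) (auto simp: Pi_iff smult_l_distr intro!: finsum_cong')
  also have "\<dots> \<oplus> ?t (Suc m) 0 = (\<Oplus>k\<in>{..Suc m}. qbinomial p (Suc m) k \<odot> ?t (Suc m) k)"
    using u v t by (subst finsum_Suc2) (auto simp: Pi_iff)
  finally show ?case .
qed

text \<open>Only the two extreme terms of the quantum binomial formula survive. This gives
  \<Delta>(x)^n = 0 below.\<close>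

lemma quantum_frobenius:
  assumes u: "u \<in> carrier A" and v: "v \<in> carrier A" and uv: "u \<otimes> v = p \<odot> (v \<otimes> u)"
    and p: "primitive_root_of_unity n p"
  shows "(u \<oplus> v) [^] n = u [^] n \<oplus> v [^] n"
proof -
  have "n > 0" using p by (simp add: primitive_root_of_unity_def)
  then obtain j where n: "n = Suc j" by (cases n) auto
  let ?t = "\<lambda>k. qbinomial p n k \<odot> (v [^] k \<otimes> u [^] (n - k))"
  have t: "?t k \<in> carrier A" for k using u v by simp
  \<comment> \<open>Since n > 0, the indices 0 and n are distinct and the two surviving terms are
    not merged.\<close>
  have "(\<Oplus>k\<in>{..n}. ?t k) = (\<Oplus>k\<in>{..n}. if k = 0 then u [^] n else if k = n then v [^] n else \<zero>)"
    using u v \<open>n > 0\<close>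
    by (intro finsum_cong') (auto simp: qbinomial_self qbinomial_root_of_unity[OF p])
  also have "\<dots> = (\<Oplus>k\<in>{..j}. if k = j then v [^] n else \<zero>) \<oplus> u [^] n"
    unfolding n using u v by (subst finsum_Suc2) (auto simp: Pi_iff simp del: nat_pow_Suc)
  also have "\<dots> = u [^] n \<oplus> v [^] n"
    using u v finsum_singleton[of j "{..j}" "\<lambda>_. v [^] n"] by (simp add: a_comm eq_commute[of _ j])
  finally show ?thesis
    using quantum_binomial[OF u v uv, of n] by simp
qed

end

section \<open>Presented algebras\<close>

lemma monoid_free_monoid: "monoid free_monoid"
  by (rule monoidI) (auto simp: free_monoid_def)

lemma k_algebra_free_algebra: "k_algebra (free_algebra :: ('k::field, 'x list \<Rightarrow>\<^sub>0 'k) module)"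
  by (rule k_algebra_monoid_algebra[OF monoid_free_monoid])

lemma free_monoid_simps [simp]:
  "carrier free_monoid = UNIV" "mult free_monoid = (@)" "one free_monoid = []"
  by (simp_all add: free_monoid_def)

context k_algebra begin

lemma word_eval_Nil [simp]: "word_eval A f [] = \<one>"
  and word_eval_Cons [simp]: "word_eval A f (a # w) = f a \<otimes> word_eval A f w"
  by (simp_all add: word_eval_def)

lemma word_eval_closed [simp]: "(\<And>a. f a \<in> carrier A) \<Longrightarrow> word_eval A f w \<in> carrier A"
  by (induction w) auto

lemma word_eval_append: "(\<And>a. f a \<in> carrier A) \<Longrightarrow> word_eval A f (u @ v) = word_eval A f u \<otimes> word_eval A f v"
  by (induction u) (auto simp: m_assoc)

lemma free_algebra_hom:
  "(\<And>a. f a \<in> carrier A) \<Longrightarrow> algebra_hom free_algebra A (lin_ext A (word_eval A f))"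
  by (rule lin_ext_algebra_hom[OF _ monoid_free_monoid]) (auto simp: word_eval_append)

end

context
  fixes rels :: "('x list \<Rightarrow>\<^sub>0 'k::field) set"
begin

interpretation F: k_algebra "free_algebra :: ('k, 'x list \<Rightarrow>\<^sub>0 'k) module"
  by (rule k_algebra_free_algebra)

abbreviation rel_ideal where
  "rel_ideal \<equiv> genideal (free_algebra :: ('k, 'x list \<Rightarrow>\<^sub>0 'k) module) rels"

lemma ideal_rel_ideal: "ideal rel_ideal free_algebra"
  by (rule F.genideal_ideal) simp

lemma k_algebra_presented: "k_algebra (presented_algebra rels)"
  unfolding presented_algebra_def by (rule k_algebra_quotient[OF k_algebra_free_algebra ideal_rel_ideal])

lemma presented_proj_hom:
  "algebra_hom free_algebra (presented_algebra rels) (\<lambda>p. rel_ideal +>\<^bsub>free_algebra\<^esub> p)"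
  unfolding presented_algebra_def by (rule quotient_proj_algebra_hom[OF k_algebra_free_algebra ideal_rel_ideal])

lemma presented_rel_zero:
  "p \<in> rels \<Longrightarrow> rel_ideal +>\<^bsub>free_algebra\<^esub> p = \<zero>\<^bsub>presented_algebra rels\<^esub>"
  unfolding presented_algebra_def using F.genideal_self[of rels]
  by (intro quotient_proj_zero[OF k_algebra_free_algebra ideal_rel_ideal]) auto

lemma gen_class_closed: "gen_class rels a \<in> carrier (presented_algebra rels)"
  unfolding gen_class_def using linear_map_closed[OF algebra_hom_linear[OF presented_proj_hom]] by simp

lemma presented_proj_word:
  "rel_ideal +>\<^bsub>free_algebra\<^esub> Poly_Mapping.single w 1 = word_eval (presented_algebra rels) (gen_class rels) w"
proof (induction w)
  interpret H: k_algebra "presented_algebra rels" by (rule k_algebra_presented)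
  case Nil
  show ?case using algebra_hom_one[OF presented_proj_hom] by simp
  case (Cons a w)
  then show ?case
    using algebra_hom_mult[OF presented_proj_hom, of "Poly_Mapping.single [a] 1" "Poly_Mapping.single w 1"]
    by (simp add: gen_class_def)
qed

text \<open>Monomials in the generators span the free algebra, hence also its quotient. The form
  with a subspace \<open>W\<close> fits the use with equalizers.\<close>

lemma presented_span:
  assumes W: "linear_subspace (presented_algebra rels) W"
    and words: "\<And>w. word_eval (presented_algebra rels) (gen_class rels) w \<in> W"
  shows "carrier (presented_algebra rels) \<subseteq> W"
proof
  fix C assume "C \<in> carrier (presented_algebra rels)"
  then obtain p where C: "C = rel_ideal +>\<^bsub>free_algebra\<^esub> p"
    by (auto simp: presented_algebra_def carrier_quotient_algebra)
  note lin = algebra_hom_linear[OF presented_proj_hom]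
  have "Poly_Mapping.keys p \<subseteq> UNIV" by simp
  then show "C \<in> W"
    unfolding C
  proof (induction p rule: poly_mapping_carrier_induct)
    case zero
    show ?case
      using linear_map_zero[OF k_algebra_free_algebra k_algebra_presented lin] linear_subspace_zero[OF W] by simp
  next
    case (add p s)
    then show ?case using linear_map_add[OF lin, of p s] linear_subspace_add[OF W] by simp
  next
    case (single w c)
    show ?case
      using linear_map_smult[OF lin, of "Poly_Mapping.single w 1" c] linear_subspace_smult[OF W words, of c w]
      by (simp add: presented_proj_word)
  qed
qed

context
  fixes B :: "('k, 'b, 'n) module_scheme" and f
  assumes B: "k_algebra B" and f: "\<And>a. f a \<in> carrier B"
    and rels: "\<And>p. p \<in> rels \<Longrightarrow> lin_ext B (word_eval B f) p = \<zero>\<^bsub>B\<^esub>"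
begin

interpretation B: k_algebra B by (rule B)

lemma rel_ideal_killed: "p \<in> rel_ideal \<Longrightarrow> lin_ext B (word_eval B f) p = \<zero>\<^bsub>B\<^esub>"
proof -
  let ?K = "{p. lin_ext B (word_eval B f) p = \<zero>\<^bsub>B\<^esub>}"
  note hom = B.free_algebra_hom[of f, OF f]
  have "linear_subspace free_algebra ?K"
    using kernel_linear_subspace[OF k_algebra_free_algebra B algebra_hom_linear[OF hom]] by simp
  \<comment> \<open>The kernel of a homomorphism is a two-sided ideal; containing the relations, it
    contains the ideal they generate.\<close>
  then have "ideal ?K free_algebra"
    using algebra_hom_mult[OF hom] linear_map_closed[OF algebra_hom_linear[OF hom]]
    by (intro idealI F.ring_axioms) (auto simp: linear_subspace_def additive_subgroup_def)
  then have "rel_ideal \<subseteq> ?K"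
    by (rule F.genideal_minimal) (use rels in auto)
  then show "p \<in> rel_ideal \<Longrightarrow> lin_ext B (word_eval B f) p = \<zero>\<^bsub>B\<^esub>" by auto
qed

lemma presented_induced_hom: "algebra_hom (presented_algebra rels) B (induced B (word_eval B f))"
  unfolding presented_algebra_def induced_def
  by (rule quotient_map_algebra_hom[OF k_algebra_free_algebra ideal_rel_ideal B B.free_algebra_hom[OF f]])
    (rule rel_ideal_killed)

lemma presented_induced_gen: "induced B (word_eval B f) (gen_class rels a) = f a"
proof -
  have "induced B (word_eval B f) (gen_class rels a) = lin_ext B (word_eval B f) (Poly_Mapping.single [a] 1)"
    unfolding induced_def gen_class_def
    by (rule quotient_map_the_elem[OF k_algebra_free_algebra ideal_rel_ideal B
          algebra_hom_linear[OF B.free_algebra_hom[OF f]]])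
      (auto intro: rel_ideal_killed)
  then show ?thesis using f by simp
qed

end

end

section \<open>Roots of unity\<close>

lemma primitive_root_power_eq_1_iff:
  assumes "primitive_root_of_unity M q"
  shows "q ^ s = 1 \<longleftrightarrow> M dvd s"
proof -
  have "q ^ s = q ^ (s mod M)"
  proof -
    have "q ^ s = (q ^ M) ^ (s div M) * q ^ (s mod M)"
      by (simp flip: power_mult power_add)
    also have "\<dots> = q ^ (s mod M)"
      using assms by (simp add: primitive_root_of_unity_def)
    finally show ?thesis .
  qed
  then show ?thesis
    using assms by (auto simp: primitive_root_of_unity_def dvd_eq_mod_eq_0)
qed

text \<open>Orthogonality of the characters of the cyclic group of order \<open>M\<close>: off the
  multiples of \<open>M\<close> this is a geometric sum with ratio different from 1 whose
  \<open>M\<close>-th power is 1.\<close>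

lemma primitive_root_power_sum:
  fixes q :: "'k::field"
  assumes "primitive_root_of_unity M q"
  shows "(\<Sum>k<M. q ^ (s * k)) = (if M dvd s then of_nat M else 0)"
proof (cases "M dvd s")
  case True
  then have "q ^ s = 1" by (simp add: primitive_root_power_eq_1_iff[OF assms])
  then show ?thesis using True by (simp add: power_mult)
next
  case False
  then have "q ^ s \<noteq> 1" by (simp add: primitive_root_power_eq_1_iff[OF assms])
  moreover have "(q ^ s) ^ M = 1"
    using assms by (simp add: primitive_root_of_unity_def mult.commute flip: power_mult)
      (simp add: power_mult)
  ultimately have "(\<Sum>k<M. (q ^ s) ^ k) = 0"
    by (simp add: geometric_sum)
  with False show ?thesis by (simp add: power_mult)
qed

text \<open>If the characteristic \<open>p\<close> divided \<open>M\<close>, then \<open>(q ^ (M div p) - 1) ^ p = q ^ M - 1 = 0\<close>.\<close>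

lemma primitive_root_of_nat_nonzero:
  fixes q :: "'k::field"
  assumes "primitive_root_of_unity M q"
  shows "(of_nat M :: 'k) \<noteq> 0"
proof
  assume "(of_nat M :: 'k) = 0"
  then have dvd: "CHAR('k) dvd M" by (simp add: of_nat_eq_0_iff_char_dvd)
  have M: "M > 0" "q ^ M = 1" using assms by (simp_all add: primitive_root_of_unity_def)
  with dvd have "CHAR('k) > 0" by (auto intro!: Nat.gr0I)
  then have p: "prime CHAR('k)" by (rule prime_CHAR_semidom)
  from dvd obtain t where t: "M = CHAR('k) * t" by auto
  have "q ^ M = ((q ^ t - 1) + 1) ^ CHAR('k)"
    by (simp add: t power_mult mult.commute)
  also have "\<dots> = (q ^ t - 1) ^ CHAR('k) + 1"
    by (subst freshmans_dream[OF p refl]) simp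
  finally have "q ^ t = 1"
    using M by simp
  then have "M dvd t" by (simp add: primitive_root_power_eq_1_iff[OF assms])
  then show False
    using M(1) t p prime_gt_1_nat[OF p] by (auto dest!: dvd_imp_le)
qed

section \<open>Vanishing of infinitesimal R-matrices\<close>

lemma (in k_algebra) pure_tensor2_mult:
  "\<lbrakk>a \<in> carrier A; b \<in> carrier A; c \<in> carrier A; d \<in> carrier A\<rbrakk> \<Longrightarrow>
    pure_tensor A [a, b] \<otimes>\<^bsub>tensor_power A 2\<^esub> pure_tensor A [c, d] = pure_tensor A [a \<otimes> c, b \<otimes> d]"
  by (subst pure_tensor_mult) auto

lemma (in k_algebra) pure_tensor2_one: "\<one>\<^bsub>tensor_power A 2\<^esub> = pure_tensor A [\<one>, \<one>]"
  by (simp add: pure_tensor_one numeral_2_eq_2)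

lemma (in k_algebra) pure_tensor2_pow:
  assumes "a \<in> carrier A" "b \<in> carrier A"
  shows "pure_tensor A [a, b] [^]\<^bsub>tensor_power A 2\<^esub> (k::nat) = pure_tensor A [a [^] k, b [^] k]"
proof -
  interpret T: k_algebra "tensor_power A 2" by (rule k_algebra_tensor_power)
  show ?thesis
    using assms by (induction k) (auto simp: pure_tensor2_mult pure_tensor2_one)
qed

lemma (in k_algebra) pure_tensor2_smult:
  assumes "a \<in> carrier A" "b \<in> carrier A"
  shows "pure_tensor A [c \<odot> a, b] = c \<odot>\<^bsub>tensor_power A 2\<^esub> pure_tensor A [a, b]"
    and "pure_tensor A [a, c \<odot> b] = c \<odot>\<^bsub>tensor_power A 2\<^esub> pure_tensor A [a, b]"
  using assms linear_map_smult[OF pure_tensor_linear2(1)] linear_map_smult[OF pure_tensor_linear2(2)]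
  by auto

lemma (in k_algebra) pure_tensor2_zero:
  assumes "a \<in> carrier A"
  shows "pure_tensor A [\<zero>, a] = \<zero>\<^bsub>tensor_power A 2\<^esub>" "pure_tensor A [a, \<zero>] = \<zero>\<^bsub>tensor_power A 2\<^esub>"
  using assms linear_map_zero[OF k_algebra_axioms k_algebra_tensor_power pure_tensor_linear2(1)]
    linear_map_zero[OF k_algebra_axioms k_algebra_tensor_power pure_tensor_linear2(2)]
  by auto

lemma (in k_algebra) algebra_hom_ground_pow:
  assumes "algebra_hom A ground_algebra \<phi>" "a \<in> carrier A"
  shows "\<phi> (a [^] (m::nat)) = \<phi> a ^ m"
  using assms by (induction m) (auto simp: algebra_hom_mult algebra_hom_one)

text \<open>The properties of the Radford algebra on which the vanishing argument rests, separated
  from its presentation. The characters are indexed by the \<open>M\<close>-th root of unity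
  \<open>c\<close> rather than by an exponent, so that convolution becomes \<open>c * d\<close>
  without reduction modulo \<open>M\<close>. The assumption \<open>span\<close> speaks of unbounded
  exponents, and \<open>2 * n \<le> M\<close> is what r \<ge> 2 contributes.\<close>

locale radford_like =
  fixes H :: "('k::field, 'a, 'm) bialgebra_scheme" (structure)
    and g x :: 'a and M n :: nat and q :: 'k and \<phi> :: "'k \<Rightarrow> 'a \<Rightarrow> 'k"
  assumes k_algebra: "k_algebra H"
    and \<Delta>_linear: "linear_map H (tensor_power H 2) (comult H)"
    and g [simp]: "g \<in> carrier H" and x [simp]: "x \<in> carrier H"
    and g_pow: "g [^] M = \<one>" and x_pow: "x [^] n = \<zero>" and xg: "x \<otimes> g = q \<odot> (g \<otimes> x)"
    and span: "\<And>W. linear_subspace H W \<Longrightarrow> (\<And>l m. g [^] (l::nat) \<otimes> x [^] (m::nat) \<in> W) \<Longrightarrow> carrier H \<subseteq> W"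
    and \<phi>: "\<And>c. c ^ M = 1 \<Longrightarrow> algebra_hom H ground_algebra (\<phi> c)"
    and \<phi>_g: "\<And>c. c ^ M = 1 \<Longrightarrow> \<phi> c g = c" and \<phi>_x: "\<And>c. c ^ M = 1 \<Longrightarrow> \<phi> c x = 0"
    and \<phi>_\<Delta>: "\<And>c d h. c ^ M = 1 \<Longrightarrow> d ^ M = 1 \<Longrightarrow> h \<in> carrier H \<Longrightarrow>
      tensor_functional H [\<phi> c, \<phi> d] (comult H h) = \<phi> (c * d) h"
    and \<Delta>_g: "comult H g = pure_tensor H [g, g]"
    and q: "primitive_root_of_unity M q"
    and n: "2 * n \<le> M"
begin

sublocale k_algebra H by (rule k_algebra)

abbreviation T2 where "T2 \<equiv> tensor_power H 2"
abbreviation T3 where "T3 \<equiv> tensor_power H 3"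

sublocale T2: k_algebra T2 by (rule k_algebra_tensor_power)
sublocale T3: k_algebra T3 by (rule k_algebra_tensor_power)

lemma q_pow_M: "(q ^ a) ^ M = 1"
  using q by (simp add: primitive_root_of_unity_def power_mult[symmetric] mult.commute)
    (simp add: power_mult)

lemma M_pos: "M > 0"
  using q by (simp add: primitive_root_of_unity_def)

lemma x_pow_zero: "n \<le> m \<Longrightarrow> x [^] m = \<zero>"
  using nat_pow_mult[OF x, of "m - n" n] x_pow by simp

abbreviation mono :: "nat \<Rightarrow> nat \<Rightarrow> 'a" where "mono l m \<equiv> g [^] l \<otimes> x [^] m"

lemma x_pow_g_pow: "x [^] m \<otimes> g [^] k = q ^ (m * k) \<odot> (g [^] (k::nat) \<otimes> x [^] (m::nat))"
proof (induction m)
  case (Suc m)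
  have "x [^] Suc m \<otimes> g [^] k = x [^] m \<otimes> (x \<otimes> g [^] k)"
    by (simp add: m_assoc)
  also have "\<dots> = q ^ k \<odot> ((x [^] m \<otimes> g [^] k) \<otimes> x)"
    by (simp add: qcommute_pow[OF x g xg] smult_mult_right m_assoc)
  also have "\<dots> = q ^ (Suc m * k) \<odot> (g [^] k \<otimes> x [^] Suc m)"
    by (simp add: Suc smult_mult_left smult_smult power_add m_assoc)
  finally show ?case .
qed simp

text \<open>The spanning property is applied to one slot at a time: first on the left with a
  monomial fixed on the right, then on the right with any element on the left.\<close>

lemma T2_eqI:
  assumes B: "k_algebra B" and h: "linear_map T2 B h" and k: "linear_map T2 B k"
    and eq: "\<And>l m l' m'. h (pure_tensor H [mono l m, mono l' m']) = k (pure_tensor H [mono l m, mono l' m'])"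
    and X: "X \<in> carrier T2"
  shows "h X = k X"
proof (rule tensor2_linear_map_eqI[OF B h k _ X])
  have left: "h (pure_tensor H [a, mono l' m']) = k (pure_tensor H [a, mono l' m'])" if "a \<in> carrier H" for a l' m'
  proof -
    have "carrier H \<subseteq> {a \<in> carrier H. h (pure_tensor H [a, mono l' m']) = k (pure_tensor H [a, mono l' m'])}"
      by (rule span[OF equalizer_linear_subspace[OF k_algebra B linear_map_comp[OF pure_tensor_linear2(1) h]
            linear_map_comp[OF pure_tensor_linear2(1) k]]]) (simp_all add: eq)
    with that show ?thesis by blast
  qed
  fix a b assume a: "a \<in> carrier H" and b: "b \<in> carrier H"
  have "carrier H \<subseteq> {b \<in> carrier H. h (pure_tensor H [a, b]) = k (pure_tensor H [a, b])}"
    by (rule span[OF equalizer_linear_subspace[OF k_algebra B linear_map_comp[OF pure_tensor_linear2(2) h]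
          linear_map_comp[OF pure_tensor_linear2(2) k]]]) (simp_all add: left a)
  with b show "h (pure_tensor H [a, b]) = k (pure_tensor H [a, b])" by blast
qed

lemma pure_closed [simp]: "a \<in> carrier H \<Longrightarrow> b \<in> carrier H \<Longrightarrow> pure_tensor H [a, b] \<in> carrier T2"
  by (auto intro: pure_tensor_closed)

abbreviation \<Phi> :: "nat \<Rightarrow> nat \<Rightarrow> ('a list \<Rightarrow>\<^sub>0 'k) set \<Rightarrow> 'k" where
  "\<Phi> a b \<equiv> tensor_functional H [\<phi> (q ^ a), \<phi> (q ^ b)]"

lemma \<Phi>_hom: "algebra_hom T2 ground_algebra (\<Phi> a b)"
  by (rule tensor_functional2[OF \<phi>[OF q_pow_M] \<phi>[OF q_pow_M]])

text \<open>Here \<open>0 ^ m\<close> is 1 for m = 0 and 0 otherwise, so one formula covers the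
  powers of \<open>g\<close> and the monomials that the characters kill.\<close>

lemma \<Phi>_mono: "\<Phi> a b (pure_tensor H [mono l m, mono l' m']) = q ^ (a * l) * 0 ^ m * (q ^ (b * l') * 0 ^ m')"
proof -
  have "\<phi> (q ^ a) (mono l m) = q ^ (a * l) * 0 ^ m" for a l m
    using algebra_hom_mult[OF \<phi>[OF q_pow_M[of a]], of "g [^] l" "x [^] m"]
    by (simp add: algebra_hom_ground_pow[OF \<phi>[OF q_pow_M]] \<phi>_g[OF q_pow_M] \<phi>_x[OF q_pow_M] power_mult)
  then show ?thesis
    by (simp add: tensor_functional2[OF \<phi>[OF q_pow_M] \<phi>[OF q_pow_M]])
qed

text \<open>The sum of the conjugates of \<open>X\<close> under the powers of g \<otimes> g. The
  exponent \<open>M - k\<close> encodes the inverse of g^k, as g^M = 1. Divided by \<open>M\<close>,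
  this is the averaging projection onto the elements commuting with g \<otimes> g.\<close>

definition conj_sum :: "('a list \<Rightarrow>\<^sub>0 'k) set \<Rightarrow> ('a list \<Rightarrow>\<^sub>0 'k) set" where
  "conj_sum X = (\<Oplus>\<^bsub>T2\<^esub>k\<in>{..<M}. pure_tensor H [g [^] (M - k), g [^] (M - k)] \<otimes>\<^bsub>T2\<^esub> X
     \<otimes>\<^bsub>T2\<^esub> pure_tensor H [g [^] k, g [^] k])"

lemma conj_sum_linear: "linear_map T2 T2 conj_sum"
  unfolding conj_sum_def
  by (intro linear_map_finsum T2.k_algebra_axioms linear_map_mult) auto

text \<open>Moving g^k to the left past x^m costs q^(m k), and the powers of \<open>g\<close> then
  cancel; so the pure tensors of monomials are eigenvectors.\<close>

lemma conj_sum_mono: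
  "conj_sum (pure_tensor H [mono l m, mono l' m']) =
    (\<Sum>k<M. q ^ ((m + m') * k)) \<odot>\<^bsub>T2\<^esub> pure_tensor H [mono l m, mono l' m']"
proof -
  have conj: "g [^] (M - k) \<otimes> mono l m \<otimes> g [^] k = q ^ (m * k) \<odot> mono l m" if "k < M" for k l m
  proof -
    have "g [^] (M - k) \<otimes> mono l m \<otimes> g [^] k = g [^] (M - k) \<otimes> (g [^] l \<otimes> (x [^] m \<otimes> g [^] k))"
      by (simp add: m_assoc)
    also have "\<dots> = q ^ (m * k) \<odot> (g [^] (M - k + l + k) \<otimes> x [^] m)"
      by (simp add: x_pow_g_pow smult_mult_right m_assoc flip: nat_pow_mult)
    also have "M - k + l + k = M + l" using that by simp
    also have "g [^] (M + l) = g [^] l"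
      by (simp add: g_pow flip: nat_pow_mult)
    finally show ?thesis .
  qed
  have "conj_sum (pure_tensor H [mono l m, mono l' m']) =
      (\<Oplus>\<^bsub>T2\<^esub>k\<in>{..<M}. q ^ ((m + m') * k) \<odot>\<^bsub>T2\<^esub> pure_tensor H [mono l m, mono l' m'])"
    unfolding conj_sum_def
    by (intro T2.finsum_cong')
      (auto simp: pure_tensor2_mult conj pure_tensor2_smult T2.smult_smult distrib_left power_add mult.commute)
  then show ?thesis by (simp add: T2.finsum_smult_const)
qed

text \<open>The inverse discrete Fourier transform of the scalars \<open>\<Phi> a b X\<close>,
  without the normalizing factor. The exponent \<open>(M - 1) * l\<close> stands for -l modulo
  \<open>M\<close> and avoids negative powers.\<close>

definition fourier_coeff :: "nat \<times> nat \<Rightarrow> ('a list \<Rightarrow>\<^sub>0 'k) set \<Rightarrow> 'k" where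
  "fourier_coeff = (\<lambda>(l, l') X. \<Sum>a<M. \<Sum>b<M. q ^ (a * ((M - 1) * l)) * q ^ (b * ((M - 1) * l')) * \<Phi> a b X)"

lemma fourier_coeff_linear: "linear_map T2 ground_algebra (fourier_coeff i)"
  by (cases i, intro linear_mapI)
    (auto simp: fourier_coeff_def linear_map_add[OF algebra_hom_linear[OF \<Phi>_hom]]
      linear_map_smult[OF algebra_hom_linear[OF \<Phi>_hom]] sum.distrib sum_distrib_left algebra_simps)

text \<open>The projection onto the span of the \<open>g ^ l \<otimes> g ^ l'\<close>, up to the factor \<open>M ^ 2\<close>.\<close>

definition fourier_proj :: "('a list \<Rightarrow>\<^sub>0 'k) set \<Rightarrow> ('a list \<Rightarrow>\<^sub>0 'k) set" where
  "fourier_proj X = (\<Oplus>\<^bsub>T2\<^esub>i\<in>{..<M} \<times> {..<M}.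
     fourier_coeff i X \<odot>\<^bsub>T2\<^esub> pure_tensor H [g [^] fst i, g [^] snd i])"

lemma fourier_proj_linear: "linear_map T2 T2 fourier_proj"
  unfolding fourier_proj_def
  by (intro linear_map_finsum T2.k_algebra_axioms linear_map_vector fourier_coeff_linear) auto

text \<open>Modulo \<open>M\<close> the left-hand sum is s - l, and the range of \<open>l\<close>
  makes it the residue of \<open>s\<close>. The integers supply a genuine subtraction.\<close>

lemma dvd_sub_iff:
  assumes "l < M"
  shows "M dvd s + (M - 1) * l \<longleftrightarrow> l = s mod M"
proof -
  have "int (s + (M - 1) * l) = (int s - int l) + int M * int l"
    using M_pos by (cases M) (simp_all add: algebra_simps)
  then have "M dvd s + (M - 1) * l \<longleftrightarrow> int M dvd int s - int l"
    by (metis dvd_add_left_iff dvd_triv_left int_dvd_int_iff)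
  also have "\<dots> \<longleftrightarrow> int s mod int M = int l mod int M"
    by (simp add: mod_eq_dvd_iff)
  also have "\<dots> \<longleftrightarrow> l = s mod M"
    using assms by (simp flip: zmod_int) linarith
  finally show ?thesis .
qed

text \<open>The double sum factors into two sums of powers of \<open>q\<close>, one for each tensor
  factor, and orthogonality evaluates each of them.\<close>

lemma fourier_coeff_mono:
  assumes "l < M" "l' < M"
  shows "fourier_coeff (l, l') (pure_tensor H [mono s m, mono s' m']) =
    (if m = 0 \<and> m' = 0 \<and> l = s mod M \<and> l' = s' mod M then of_nat M ^ 2 else 0)"
proof -
  have "fourier_coeff (l, l') (pure_tensor H [mono s m, mono s' m']) =
      (\<Sum>a<M. \<Sum>b<M. (q ^ ((s + (M - 1) * l) * a) * 0 ^ m) * (q ^ ((s' + (M - 1) * l') * b) * 0 ^ m'))"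
    unfolding fourier_coeff_def prod.case \<Phi>_mono
    by (intro sum.cong refl) (simp add: power_add mult_ac distrib_left distrib_right)
  also have "\<dots> = ((\<Sum>a<M. q ^ ((s + (M - 1) * l) * a)) * 0 ^ m) *
      ((\<Sum>b<M. q ^ ((s' + (M - 1) * l') * b)) * 0 ^ m')"
    by (simp only: sum_product[symmetric] sum_distrib_right[symmetric])
  also have "\<dots> = (if m = 0 \<and> m' = 0 \<and> l = s mod M \<and> l' = s' mod M then of_nat M ^ 2 else 0)"
    unfolding primitive_root_power_sum[OF q] dvd_sub_iff[OF assms(1)] dvd_sub_iff[OF assms(2)]
    by (auto simp: power2_eq_square power_0_left)
  finally show ?thesis .
qed

lemma fourier_proj_mono:
  "fourier_proj (pure_tensor H [mono s m, mono s' m']) =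
    (if m = 0 \<and> m' = 0 then of_nat M ^ 2 else 0) \<odot>\<^bsub>T2\<^esub> pure_tensor H [mono s m, mono s' m']"
proof -
  \<comment> \<open>The exponents \<open>s\<close> and \<open>s'\<close> are arbitrary, so the
    single index that can contribute is their pair of residues; g^M = 1 turns the residues back into
    \<open>s\<close> and \<open>s'\<close>.\<close>
  let ?i = "(s mod M, s' mod M)"
  have g_mod: "g [^] (s mod M) = g [^] s" for s
  proof -
    have "g [^] s = (g [^] M) [^] (s div M) \<otimes> g [^] (s mod M)"
      by (simp add: nat_pow_pow nat_pow_mult)
    also have "\<dots> = g [^] (s mod M)"
      by (simp add: g_pow)
    finally show ?thesis by simp
  qed
  let ?c = "if m = 0 \<and> m' = 0 then of_nat M ^ 2 else (0::'k)"
  have "fourier_coeff i (pure_tensor H [mono s m, mono s' m']) \<odot>\<^bsub>T2\<^esub> pure_tensor H [g [^] fst i, g [^] snd i] =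
      (if ?i = i then ?c \<odot>\<^bsub>T2\<^esub> pure_tensor H [g [^] fst i, g [^] snd i] else \<zero>\<^bsub>T2\<^esub>)"
    if "i \<in> {..<M} \<times> {..<M}" for i
  proof -
    from that obtain l l' where i: "i = (l, l')" "l < M" "l' < M" by auto
    show ?thesis unfolding i(1) fourier_coeff_mono[OF i(2,3)] by auto
  qed
  then have "fourier_proj (pure_tensor H [mono s m, mono s' m']) =
      (\<Oplus>\<^bsub>T2\<^esub>i\<in>{..<M} \<times> {..<M}. if ?i = i then ?c \<odot>\<^bsub>T2\<^esub> pure_tensor H [g [^] fst i, g [^] snd i] else \<zero>\<^bsub>T2\<^esub>)"
    unfolding fourier_proj_def by (intro T2.finsum_cong') simp_all
  also have "\<dots> = ?c \<odot>\<^bsub>T2\<^esub> pure_tensor H [g [^] s, g [^] s']"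
    using M_pos by (subst T2.finsum_singleton) (auto simp: g_mod)
  finally show ?thesis by auto
qed

text \<open>Both operators are diagonal on the pure tensors of monomials, so comparing eigenvalues
  suffices: both sides scale a tensor of powers of \<open>g\<close> by M^3 and kill every other
  monomial tensor. The outer factors balance the missing normalizations.\<close>

lemma fourier_proj_conj_sum:
  assumes "X \<in> carrier T2"
  shows "of_nat M ^ 2 \<odot>\<^bsub>T2\<^esub> conj_sum X = of_nat M \<odot>\<^bsub>T2\<^esub> fourier_proj X"
proof (rule T2_eqI[OF T2.k_algebra_axioms linear_map_scale[OF T2.k_algebra_axioms conj_sum_linear]
      linear_map_scale[OF T2.k_algebra_axioms fourier_proj_linear] _ assms])
  fix l m l' m' :: nat
  show "of_nat M ^ 2 \<odot>\<^bsub>T2\<^esub> conj_sum (pure_tensor H [mono l m, mono l' m']) =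
      of_nat M \<odot>\<^bsub>T2\<^esub> fourier_proj (pure_tensor H [mono l m, mono l' m'])"
  proof (cases "n \<le> m \<or> n \<le> m'")
    case True
    \<comment> \<open>Here the two scalars need not match, since \<open>M\<close> may divide m + m',
      but the tensor itself is zero.\<close>
    then have "pure_tensor H [mono l m, mono l' m'] = \<zero>\<^bsub>T2\<^esub>"
      by (auto simp: x_pow_zero pure_tensor2_zero)
    then show ?thesis
      unfolding conj_sum_mono fourier_proj_mono by (simp add: T2.smult_smult)
  next
    case False
    \<comment> \<open>As m and m' are at most n - 1, their sum is below 2n and so below
      \<open>M\<close>.\<close>
    then have "m + m' < M" using n by simp
    then have "M dvd m + m' \<longleftrightarrow> m = 0 \<and> m' = 0" by (auto dest: dvd_imp_le)
    then show ?thesis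
      by (simp add: conj_sum_mono fourier_proj_mono T2.smult_smult primitive_root_power_sum[OF q])
        (auto simp: power2_eq_square mult.assoc)
  qed
qed

lemma conj_sum_commuting:
  assumes "X \<in> carrier T2" and comm: "X \<otimes>\<^bsub>T2\<^esub> pure_tensor H [g, g] = pure_tensor H [g, g] \<otimes>\<^bsub>T2\<^esub> X"
  shows "conj_sum X = of_nat M \<odot>\<^bsub>T2\<^esub> X"
proof -
  have pow: "X \<otimes>\<^bsub>T2\<^esub> pure_tensor H [g [^] k, g [^] k] = pure_tensor H [g [^] k, g [^] k] \<otimes>\<^bsub>T2\<^esub> X" for k :: nat
    \<comment> \<open>Commuting is the case of factor 1 of commuting up to a scalar.\<close>
    using T2.qcommute_pow[of X "pure_tensor H [g, g]" 1 k] assms by (simp add: pure_tensor2_pow)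
  have "pure_tensor H [g [^] (M - k), g [^] (M - k)] \<otimes>\<^bsub>T2\<^esub> X \<otimes>\<^bsub>T2\<^esub> pure_tensor H [g [^] k, g [^] k] = X"
    if "k < M" for k
  proof -
    have "pure_tensor H [g [^] (M - k), g [^] (M - k)] \<otimes>\<^bsub>T2\<^esub> X \<otimes>\<^bsub>T2\<^esub> pure_tensor H [g [^] k, g [^] k] =
        pure_tensor H [g [^] (M - k), g [^] (M - k)] \<otimes>\<^bsub>T2\<^esub> pure_tensor H [g [^] k, g [^] k] \<otimes>\<^bsub>T2\<^esub> X"
      using assms(1) by (simp add: T2.m_assoc pow)
    also have "\<dots> = pure_tensor H [\<one>, \<one>] \<otimes>\<^bsub>T2\<^esub> X"
      using that by (simp add: pure_tensor2_mult nat_pow_mult g_pow)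
    finally show ?thesis using assms(1) by (simp flip: pure_tensor2_one)
  qed
  \<comment> \<open>The scalar 1 is written out so that the \<open>M\<close> equal terms add up to a
    scalar multiple of \<open>X\<close>.\<close>
  then have "conj_sum X = (\<Oplus>\<^bsub>T2\<^esub>k\<in>{..<M}. 1 \<odot>\<^bsub>T2\<^esub> X)"
    unfolding conj_sum_def using assms(1) by (intro T2.finsum_cong') auto
  then show ?thesis using assms(1) by (subst (asm) T2.finsum_smult_const) auto
qed

text \<open>M^3 X equals M^2 times the conjugation sum, hence M times the Fourier projection, which
  is zero because all its coefficients are combinations of the vanishing scalars.\<close>

lemma commuting_eq_zeroI:
  assumes X: "X \<in> carrier T2" and "X \<otimes>\<^bsub>T2\<^esub> pure_tensor H [g, g] = pure_tensor H [g, g] \<otimes>\<^bsub>T2\<^esub> X"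
    and zero: "\<And>a b. \<Phi> a b X = 0"
  shows "X = \<zero>\<^bsub>T2\<^esub>"
proof (rule T2.smult_cancel_zero[OF X])
  show "of_nat M ^ 2 * of_nat M \<noteq> (0::'k)"
    using primitive_root_of_nat_nonzero[OF q] by simp
  have "fourier_proj X = (\<Oplus>\<^bsub>T2\<^esub>i\<in>{..<M} \<times> {..<M}. \<zero>\<^bsub>T2\<^esub>)"
    unfolding fourier_proj_def by (intro T2.finsum_cong') (auto simp: fourier_coeff_def zero)
  then show "(of_nat M ^ 2 * of_nat M) \<odot>\<^bsub>T2\<^esub> X = \<zero>\<^bsub>T2\<^esub>"
    using fourier_proj_conj_sum[OF X] conj_sum_commuting[OF assms(1,2)] X by (simp add: T2.smult_smult)
qed

theorem infinitesimal_zero: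
  assumes R: "R \<in> Units T2" and \<chi>: "infinitesimal_R_matrix H R \<chi>"
  shows "\<chi> = \<zero>\<^bsub>T2\<^esub>"
proof (rule commuting_eq_zeroI)
  show X: "\<chi> \<in> carrier T2"
    using \<chi> by (simp add: infinitesimal_R_matrix_def)
  have "\<chi> \<otimes>\<^bsub>T2\<^esub> comult H g = comult H g \<otimes>\<^bsub>T2\<^esub> \<chi>"
    using \<chi> by (simp add: infinitesimal_R_matrix_def)
  then show "\<chi> \<otimes>\<^bsub>T2\<^esub> pure_tensor H [g, g] = pure_tensor H [g, g] \<otimes>\<^bsub>T2\<^esub> \<chi>"
    by (simp add: \<Delta>_g)
  let ?\<rho> = "leg12 H R"
  note leg12 = leg12_algebra_hom
  note leg12_closed = linear_map_closed[OF algebra_hom_linear[OF leg12]]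
  from R have R_closed: "R \<in> carrier T2" and R_inv: "inv\<^bsub>T2\<^esub> R \<in> carrier T2"
    by auto
  \<comment> \<open>Invertibility in the third tensor power gives the symbol \<open>inv\<close> in
    the formula for \<chi> its meaning; the inverse is the leg of the inverse of
    \<open>R\<close>.\<close>
  have \<rho>: "?\<rho> \<in> Units T3"
    unfolding Units_def using leg12_closed[OF R_closed] leg12_closed[OF R_inv]
      algebra_hom_mult[OF leg12 R_closed R_inv] algebra_hom_mult[OF leg12 R_inv R_closed]
      algebra_hom_one[OF leg12] T2.Units_r_inv[OF R] T2.Units_l_inv[OF R]
    by (auto intro!: bexI[of _ "leg12 H (inv\<^bsub>T2\<^esub> R)"])
  have eq: "id_comult H \<chi> = leg12 H \<chi> \<oplus>\<^bsub>T3\<^esub> inv\<^bsub>T3\<^esub> ?\<rho> \<otimes>\<^bsub>T3\<^esub> leg13 H \<chi> \<otimes>\<^bsub>T3\<^esub> ?\<rho>"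
    using \<chi> by (simp add: infinitesimal_R_matrix_def)
  have additive: "tensor_functional H [\<phi> c, \<phi> (d * e)] \<chi> =
      tensor_functional H [\<phi> c, \<phi> d] \<chi> + tensor_functional H [\<phi> c, \<phi> e] \<chi>"
    if c: "c ^ M = 1" and d: "d ^ M = 1" and e: "e ^ M = 1" for c d e
  proof -
    let ?f = "tensor_functional H [\<phi> c, \<phi> d, \<phi> e]"
    have de: "(d * e) ^ M = 1" using d e by (simp add: power_mult_distrib)
    have hom: "algebra_hom T3 ground_algebra ?f"
      by (rule tensor_functional3) (use \<phi> c d e in auto)
    note legs = tensor_functional_legs[OF k_algebra \<Delta>_linear \<phi>[OF c] \<phi>[OF d] \<phi>[OF e] X]
    have closed: "leg12 H \<chi> \<in> carrier T3" "leg13 H \<chi> \<in> carrier T3" "?\<rho> \<in> carrier T3" "inv\<^bsub>T3\<^esub> ?\<rho> \<in> carrier T3"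
      using X R_closed \<rho> leg12_closed linear_map_closed[OF leg13_linear] by auto
    \<comment> \<open>A character sends inverse elements to inverse scalars, and in the field these
      cancel around the value of the middle factor.\<close>
    have "?f (inv\<^bsub>T3\<^esub> ?\<rho>) * ?f ?\<rho> = 1"
      using algebra_hom_mult[OF hom closed(4,3)] algebra_hom_one[OF hom] T3.Units_l_inv[OF \<rho>] by simp
    then have "?f (id_comult H \<chi>) = ?f (leg12 H \<chi>) + ?f (leg13 H \<chi>)"
      unfolding eq using closed
      by (simp add: linear_map_add[OF algebra_hom_linear[OF hom]] algebra_hom_mult[OF hom] mult.commute)
    then show ?thesis
      using legs(1,2) legs(3)[OF \<phi>_\<Delta>[OF d e] \<phi>[OF de]] by simp
  qed
  fix a b
  let ?F = "\<lambda>d. tensor_functional H [\<phi> (q ^ a), \<phi> d] \<chi>"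
  \<comment> \<open>Since 1 * 1 = 1, additivity says that \<open>?F 1\<close> equals its own double,
    which forces it to vanish.\<close>
  have "?F (1 * 1) = ?F 1 + ?F 1"
    by (rule additive) (simp_all add: q_pow_M)
  then have F_1: "?F 1 = 0"
    by (metis add_cancel_right_right mult_1)
  have "?F ((q ^ b) ^ k) = of_nat k * ?F (q ^ b)" for k
  proof (induction k)
    case (Suc k)
    have "((q ^ b) ^ k) ^ M = 1"
      using q_pow_M[of "b * k"] by (simp add: power_mult)
    then show ?case
      using additive[OF q_pow_M q_pow_M[of b], of "(q ^ b) ^ k" a] Suc by (simp add: algebra_simps)
  qed (use F_1 in simp)
  from this[of M] show "\<Phi> a b \<chi> = 0"
    \<comment> \<open>At k = M the left side is \<open>?F 1 = 0\<close>, and the factor M on the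
      right is non-zero in the field.\<close>
    using F_1 q_pow_M primitive_root_of_nat_nonzero[OF q] by simp
qed

end

section \<open>The Radford Hopf algebra\<close>

lemma ground_minus [simp]: "a \<ominus>\<^bsub>ground_algebra\<^esub> b = a - (b :: 'k::field)"
proof -
  interpret k_algebra "ground_algebra :: ('k, 'k) module" by (rule k_algebra_ground)
  have "\<ominus>\<^bsub>ground_algebra\<^esub> b = - b"
    by (rule minus_equality) simp_all
  then show ?thesis by (simp add: a_minus_def)
qed

lemma ground_pow [simp]: "a [^]\<^bsub>ground_algebra\<^esub> (m::nat) = (a :: 'k::field) ^ m"
proof -
  interpret k_algebra "ground_algebra :: ('k, 'k) module" by (rule k_algebra_ground)
  show ?thesis by (induction m) simp_all
qed

lemma presented_hom_eqI:
  assumes B: "k_algebra B" and h: "algebra_hom (presented_algebra rels) B h"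
    and k: "algebra_hom (presented_algebra rels) B k"
    and eq: "\<And>a. h (gen_class rels a) = k (gen_class rels a)"
    and p: "p \<in> carrier (presented_algebra rels)"
  shows "h p = k p"
proof -
  interpret H: k_algebra "presented_algebra rels" by (rule k_algebra_presented)
  note [simp] = gen_class_closed
  have "h (word_eval (presented_algebra rels) (gen_class rels) w) =
      k (word_eval (presented_algebra rels) (gen_class rels) w)" for w
    by (induction w) (simp_all add: algebra_hom_one[OF h] algebra_hom_one[OF k]
        algebra_hom_mult[OF h] algebra_hom_mult[OF k] eq)
  then have "carrier (presented_algebra rels) \<subseteq> {p \<in> carrier (presented_algebra rels). h p = k p}"
    by (intro presented_span equalizer_linear_subspace[OF H.k_algebra_axioms B] algebra_hom_linear[OF h]
        algebra_hom_linear[OF k]) simp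
  with p show ?thesis by blast
qed

text \<open>Stated for any homomorphism out of the free algebra because it is used twice: for the
  projection, to see that the relations hold in the quotient, and for a linear extension, to see
  that it kills them.\<close>

lemma radford_rels_image:
  fixes B :: "('k::field, 'b, 'm) module_scheme"
  assumes B: "k_algebra B" and h: "algebra_hom free_algebra B h"
    and gen: "h (Poly_Mapping.single [Gen_g] 1) = g" "h (Poly_Mapping.single [Gen_x] 1) = x"
  shows "h ` radford_rels r n q =
    {g [^]\<^bsub>B\<^esub> (r * n) \<ominus>\<^bsub>B\<^esub> \<one>\<^bsub>B\<^esub>, x [^]\<^bsub>B\<^esub> n, x \<otimes>\<^bsub>B\<^esub> g \<ominus>\<^bsub>B\<^esub> q \<odot>\<^bsub>B\<^esub> (g \<otimes>\<^bsub>B\<^esub> x)}"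
proof -
  note lin = algebra_hom_linear[OF h]
  interpret F: k_algebra "free_algebra :: ('k, radford_gen list \<Rightarrow>\<^sub>0 'k) module"
    by (rule k_algebra_free_algebra)
  have closed: "p \<in> carrier free_algebra" for p :: "radford_gen list \<Rightarrow>\<^sub>0 'k" by simp
  show ?thesis
    unfolding radford_rels_def Let_def
    by (simp only: image_insert image_empty linear_map_minus[OF k_algebra_free_algebra B lin closed closed]
        algebra_hom_pow[OF k_algebra_free_algebra B h closed] algebra_hom_mult[OF h closed closed]
        algebra_hom_one[OF h] linear_map_smult[OF lin closed] gen)
qed

lemma radford_rels_killed:
  assumes B: "k_algebra B" and f: "\<And>a. f a \<in> carrier B"
    and "f Gen_g [^]\<^bsub>B\<^esub> (r * n) = \<one>\<^bsub>B\<^esub>" "f Gen_x [^]\<^bsub>B\<^esub> n = \<zero>\<^bsub>B\<^esub>"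
    and "f Gen_x \<otimes>\<^bsub>B\<^esub> f Gen_g = q \<odot>\<^bsub>B\<^esub> (f Gen_g \<otimes>\<^bsub>B\<^esub> f Gen_x)"
    and p: "p \<in> radford_rels r n q"
  shows "lin_ext B (word_eval B f) p = \<zero>\<^bsub>B\<^esub>"
proof -
  interpret B: k_algebra B by (rule B)
  have "lin_ext B (word_eval B f) p \<in> lin_ext B (word_eval B f) ` radford_rels r n q"
    using p by (rule imageI)
  also have "\<dots> = {f Gen_g [^]\<^bsub>B\<^esub> (r * n) \<ominus>\<^bsub>B\<^esub> \<one>\<^bsub>B\<^esub>, f Gen_x [^]\<^bsub>B\<^esub> n,
      f Gen_x \<otimes>\<^bsub>B\<^esub> f Gen_g \<ominus>\<^bsub>B\<^esub> q \<odot>\<^bsub>B\<^esub> (f Gen_g \<otimes>\<^bsub>B\<^esub> f Gen_x)}"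
    by (rule radford_rels_image[OF B B.free_algebra_hom[of f, OF f]]) (simp_all add: f)
  also have "\<dots> = {\<zero>\<^bsub>B\<^esub>}"
    using assms(3-5) f by (simp add: a_minus_def B.r_neg)
  finally show ?thesis by simp
qed

section \<open>The presented algebra: relations, spanning monomials, characters and
  comultiplication\<close>

context
  fixes r n :: nat and q :: "'k::field"
begin

abbreviation "rad_g \<equiv> gen_class (radford_rels r n q) Gen_g"
abbreviation "rad_x \<equiv> gen_class (radford_rels r n q) Gen_x"
abbreviation "rad \<equiv> radford_algebra r n q"

interpretation H: k_algebra rad by (rule k_algebra_presented)

lemma radford_relations:
  shows "rad_g [^]\<^bsub>rad\<^esub> (r * n) = \<one>\<^bsub>rad\<^esub>" and "rad_x [^]\<^bsub>rad\<^esub> n = \<zero>\<^bsub>rad\<^esub>"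
    and "rad_x \<otimes>\<^bsub>rad\<^esub> rad_g = q \<odot>\<^bsub>rad\<^esub> (rad_g \<otimes>\<^bsub>rad\<^esub> rad_x)"
proof -
  let ?\<pi> = "\<lambda>p. genideal (free_algebra :: ('k, radford_gen list \<Rightarrow>\<^sub>0 'k) module) (radford_rels r n q)
    +>\<^bsub>free_algebra :: ('k, radford_gen list \<Rightarrow>\<^sub>0 'k) module\<^esub> p"
  have "?\<pi> ` radford_rels r n q \<subseteq> {\<zero>\<^bsub>rad\<^esub>}"
    using presented_rel_zero[of _ "radford_rels r n q"] by auto
  moreover have "?\<pi> ` radford_rels r n q =
    {rad_g [^]\<^bsub>rad\<^esub> (r * n) \<ominus>\<^bsub>rad\<^esub> \<one>\<^bsub>rad\<^esub>, rad_x [^]\<^bsub>rad\<^esub> n,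
     rad_x \<otimes>\<^bsub>rad\<^esub> rad_g \<ominus>\<^bsub>rad\<^esub> q \<odot>\<^bsub>rad\<^esub> (rad_g \<otimes>\<^bsub>rad\<^esub> rad_x)}"
    by (rule radford_rels_image[OF k_algebra_presented presented_proj_hom]) (simp_all add: gen_class_def)
  moreover have "a = b" if "a \<ominus>\<^bsub>rad\<^esub> b = \<zero>\<^bsub>rad\<^esub>" "a \<in> carrier rad" "b \<in> carrier rad" for a b
    using H.minus_equality[of a "\<ominus>\<^bsub>rad\<^esub> b"] that by (simp add: a_minus_def)
  ultimately show "rad_g [^]\<^bsub>rad\<^esub> (r * n) = \<one>\<^bsub>rad\<^esub>" and "rad_x [^]\<^bsub>rad\<^esub> n = \<zero>\<^bsub>rad\<^esub>"
    and "rad_x \<otimes>\<^bsub>rad\<^esub> rad_g = q \<odot>\<^bsub>rad\<^esub> (rad_g \<otimes>\<^bsub>rad\<^esub> rad_x)"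
    by (simp_all add: gen_class_closed)
qed

text \<open>Letters are prepended one by one: a \<open>g\<close> raises \<open>l\<close>, and an
  \<open>x\<close> moves past g^l at the cost of q^l and raises \<open>m\<close>. The exponents are
  left unreduced.\<close>

lemma radford_word_eval:
  "\<exists>c l m. word_eval rad (gen_class (radford_rels r n q)) w =
    c \<odot>\<^bsub>rad\<^esub> (rad_g [^]\<^bsub>rad\<^esub> (l::nat) \<otimes>\<^bsub>rad\<^esub> rad_x [^]\<^bsub>rad\<^esub> (m::nat))"
proof (induction w)
  case Nil
  show ?case by (rule exI[of _ 1], rule exI[of _ 0], rule exI[of _ 0]) simp
next
  note [simp] = gen_class_closed
  case (Cons a w)
  then obtain c l m where IH: "word_eval rad (gen_class (radford_rels r n q)) w =
      c \<odot>\<^bsub>rad\<^esub> (rad_g [^]\<^bsub>rad\<^esub> (l::nat) \<otimes>\<^bsub>rad\<^esub> rad_x [^]\<^bsub>rad\<^esub> (m::nat))"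
    by blast
  have x: "rad_x \<otimes>\<^bsub>rad\<^esub> (rad_g [^]\<^bsub>rad\<^esub> l \<otimes>\<^bsub>rad\<^esub> rad_x [^]\<^bsub>rad\<^esub> m) =
      q ^ l \<odot>\<^bsub>rad\<^esub> (rad_g [^]\<^bsub>rad\<^esub> l \<otimes>\<^bsub>rad\<^esub> rad_x [^]\<^bsub>rad\<^esub> Suc m)"
  proof -
    have "rad_x \<otimes>\<^bsub>rad\<^esub> (rad_g [^]\<^bsub>rad\<^esub> l \<otimes>\<^bsub>rad\<^esub> rad_x [^]\<^bsub>rad\<^esub> m) =
        (rad_x \<otimes>\<^bsub>rad\<^esub> rad_g [^]\<^bsub>rad\<^esub> l) \<otimes>\<^bsub>rad\<^esub> rad_x [^]\<^bsub>rad\<^esub> m"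
      by (simp add: H.m_assoc)
    also have "\<dots> = q ^ l \<odot>\<^bsub>rad\<^esub> (rad_g [^]\<^bsub>rad\<^esub> l \<otimes>\<^bsub>rad\<^esub> (rad_x \<otimes>\<^bsub>rad\<^esub> rad_x [^]\<^bsub>rad\<^esub> m))"
      by (simp add: H.qcommute_pow[OF _ _ radford_relations(3)] H.smult_mult_left H.m_assoc)
    finally show ?thesis using H.nat_pow_Suc2[of rad_x m] by simp
  qed
  show ?case
  proof (cases a)
    case Gen_g
    have "rad_g \<otimes>\<^bsub>rad\<^esub> (rad_g [^]\<^bsub>rad\<^esub> l \<otimes>\<^bsub>rad\<^esub> rad_x [^]\<^bsub>rad\<^esub> m) =
        rad_g [^]\<^bsub>rad\<^esub> Suc l \<otimes>\<^bsub>rad\<^esub> rad_x [^]\<^bsub>rad\<^esub> m"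
      by (metis H.m_assoc H.nat_pow_Suc2 H.nat_pow_closed gen_class_closed)
    then show ?thesis
      using Gen_g IH
      by (intro exI[of _ c] exI[of _ "Suc l"] exI[of _ m]) (simp add: H.smult_mult_right del: H.nat_pow_Suc)
  next
    case Gen_x
    then show ?thesis
      using IH x
      by (intro exI[of _ "c * q ^ l"] exI[of _ l] exI[of _ "Suc m"])
        (simp add: H.smult_mult_right H.smult_smult del: H.nat_pow_Suc)
  qed
qed

lemma radford_span:
  assumes W: "linear_subspace rad W"
    and mono: "\<And>l m. rad_g [^]\<^bsub>rad\<^esub> (l::nat) \<otimes>\<^bsub>rad\<^esub> rad_x [^]\<^bsub>rad\<^esub> (m::nat) \<in> W"
  shows "carrier rad \<subseteq> W"
proof (rule presented_span[OF W])
  fix w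
  show "word_eval rad (gen_class (radford_rels r n q)) w \<in> W"
    using radford_word_eval[of w] linear_subspace_smult[OF W mono] by metis
qed

definition radford_character :: "'k \<Rightarrow> (radford_gen list \<Rightarrow>\<^sub>0 'k) set \<Rightarrow> 'k" where
  "radford_character c = induced ground_algebra
     (word_eval ground_algebra (\<lambda>a. case a of Gen_g \<Rightarrow> c | Gen_x \<Rightarrow> 0))"

text \<open>The relations hold for g \<mapsto> c and x \<mapsto> 0: c^(rn) = 1 by assumption, 0^n =
  0 because n \<ge> 1, and both sides of the commutation relation vanish.\<close>

lemma radford_character:
  assumes "n \<ge> 1" and c: "c ^ (r * n) = 1"
  shows "algebra_hom rad ground_algebra (radford_character c)"
    and "radford_character c rad_g = c" and "radford_character c rad_x = 0"
proof -
  let ?f = "\<lambda>a. case a of Gen_g \<Rightarrow> c | Gen_x \<Rightarrow> 0"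
  have killed: "lin_ext ground_algebra (word_eval ground_algebra ?f) p = \<zero>\<^bsub>ground_algebra\<^esub>"
    if "p \<in> radford_rels r n q" for p
    by (rule radford_rels_killed[OF k_algebra_ground _ _ _ _ that]) (use assms in simp_all)
  show "algebra_hom rad ground_algebra (radford_character c)"
    unfolding radford_character_def
    by (rule presented_induced_hom[OF k_algebra_ground _ killed]) simp_all
  show "radford_character c rad_g = c" "radford_character c rad_x = 0"
    unfolding radford_character_def
    by (subst presented_induced_gen[OF k_algebra_ground _ killed]; simp)+
qed

abbreviation "radT2 \<equiv> tensor_power rad 2"

interpretation T2: k_algebra radT2 by (rule H.k_algebra_tensor_power)

abbreviation "rad_\<Delta> \<equiv> induced radT2 (word_eval radT2 (radford_comult_gen r n q))"

lemma radford_comult_gen_simps: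
  "radford_comult_gen r n q Gen_g = pure_tensor rad [rad_g, rad_g]"
  "radford_comult_gen r n q Gen_x =
    pure_tensor rad [\<one>\<^bsub>rad\<^esub>, rad_x] \<oplus>\<^bsub>radT2\<^esub> pure_tensor rad [rad_x, rad_g [^]\<^bsub>rad\<^esub> r]"
  by (simp_all add: radford_comult_gen_def Let_def)

context
  assumes n: "n \<ge> 1" and q: "primitive_root_of_unity (r * n) q"
begin

lemma radford_comult:
  shows "algebra_hom rad radT2 rad_\<Delta>"
    and "rad_\<Delta> (gen_class (radford_rels r n q) a) = radford_comult_gen r n q a"
proof -
  note [simp] = gen_class_closed
  let ?g = rad_g and ?x = rad_x and ?u = "pure_tensor rad [\<one>\<^bsub>rad\<^esub>, rad_x]"
    and ?v = "pure_tensor rad [rad_x, rad_g [^]\<^bsub>rad\<^esub> r]"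
  have pure [simp]: "pure_tensor rad [a, b] \<in> carrier radT2" if "a \<in> carrier rad" "b \<in> carrier rad" for a b
    using that by (auto intro: H.pure_tensor_closed)
  have closed: "radford_comult_gen r n q a \<in> carrier radT2" for a
    by (cases a) (simp_all add: radford_comult_gen_simps)
  \<comment> \<open>An exponent k < n of q^r is the exponent rk < rn of \<open>q\<close>, so the
    order of q^r is exactly n.\<close>
  have qr: "primitive_root_of_unity n (q ^ r)"
    using q n by (auto simp: primitive_root_of_unity_def power_mult[symmetric])
  have xgr: "?x \<otimes>\<^bsub>rad\<^esub> ?g [^]\<^bsub>rad\<^esub> r = q ^ r \<odot>\<^bsub>rad\<^esub> (?g [^]\<^bsub>rad\<^esub> r \<otimes>\<^bsub>rad\<^esub> ?x)"
    by (rule H.qcommute_pow[OF _ _ radford_relations(3)]) simp_all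
  \<comment> \<open>With this factor, the \<open>n\<close>-th power of the sum is the sum of the
    \<open>n\<close>-th powers, and each of these contains x^n = 0.\<close>
  have "?u \<otimes>\<^bsub>radT2\<^esub> ?v = q ^ r \<odot>\<^bsub>radT2\<^esub> (?v \<otimes>\<^bsub>radT2\<^esub> ?u)"
    by (simp add: H.pure_tensor2_mult xgr H.pure_tensor2_smult)
  from T2.quantum_frobenius[OF _ _ this qr]
  have x_pow: "radford_comult_gen r n q Gen_x [^]\<^bsub>radT2\<^esub> n = \<zero>\<^bsub>radT2\<^esub>"
    by (simp add: radford_comult_gen_simps H.pure_tensor2_pow radford_relations H.pure_tensor2_zero)
  have g_pow: "radford_comult_gen r n q Gen_g [^]\<^bsub>radT2\<^esub> (r * n) = \<one>\<^bsub>radT2\<^esub>"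
    by (simp add: radford_comult_gen_simps H.pure_tensor2_pow radford_relations H.pure_tensor2_one)
  have "?g [^]\<^bsub>rad\<^esub> r \<otimes>\<^bsub>rad\<^esub> ?g = ?g \<otimes>\<^bsub>rad\<^esub> ?g [^]\<^bsub>rad\<^esub> r"
    by (metis H.nat_pow_Suc H.nat_pow_Suc2 gen_class_closed)
  then have xg: "radford_comult_gen r n q Gen_x \<otimes>\<^bsub>radT2\<^esub> radford_comult_gen r n q Gen_g =
      q \<odot>\<^bsub>radT2\<^esub> (radford_comult_gen r n q Gen_g \<otimes>\<^bsub>radT2\<^esub> radford_comult_gen r n q Gen_x)"
    by (simp add: radford_comult_gen_simps T2.l_distr T2.r_distr H.pure_tensor2_mult radford_relations(3)
        H.pure_tensor2_smult T2.smult_r_distr)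
  have killed: "lin_ext radT2 (word_eval radT2 (radford_comult_gen r n q)) p = \<zero>\<^bsub>radT2\<^esub>"
    if "p \<in> radford_rels r n q" for p
    by (rule radford_rels_killed[OF T2.k_algebra_axioms closed g_pow x_pow xg that])
  show "algebra_hom rad radT2 rad_\<Delta>"
    by (rule presented_induced_hom[OF T2.k_algebra_axioms closed killed])
  show "rad_\<Delta> (gen_class (radford_rels r n q) a) = radford_comult_gen r n q a"
    by (rule presented_induced_gen[OF T2.k_algebra_axioms closed killed])
qed

text \<open>Both sides are algebra homomorphisms into the field, so the generators decide: g
  \<otimes> g gives c d, and each summand of \<Delta>(x) contains a factor \<open>x\<close> that a
  character kills.\<close>

lemma radford_character_comult:
  assumes c: "c ^ (r * n) = 1" and d: "d ^ (r * n) = 1" and h: "h \<in> carrier rad"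
  shows "tensor_functional rad [radford_character c, radford_character d] (rad_\<Delta> h) = radford_character (c * d) h"
proof (rule presented_hom_eqI[OF k_algebra_ground _ _ _ h])
  have cd: "(c * d) ^ (r * n) = 1" using c d by (simp add: power_mult_distrib)
  note \<phi> = radford_character[OF n c] and \<psi> = radford_character[OF n d] and \<theta> = radford_character[OF n cd]
  note f2 = H.tensor_functional2[OF \<phi>(1) \<psi>(1)]
  show "algebra_hom rad ground_algebra
      (\<lambda>h. tensor_functional rad [radford_character c, radford_character d] (rad_\<Delta> h))"
    by (rule algebra_hom_comp[OF radford_comult(1) f2(1)])
  show "algebra_hom rad ground_algebra (radford_character (c * d))" by (rule \<theta>(1))
  note [simp] = gen_class_closed
  have pure [simp]: "pure_tensor rad [a, b] \<in> carrier radT2" if "a \<in> carrier rad" "b \<in> carrier rad" for a b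
    using that by (auto intro: H.pure_tensor_closed)
  show "tensor_functional rad [radford_character c, radford_character d]
      (rad_\<Delta> (gen_class (radford_rels r n q) a)) = radford_character (c * d) (gen_class (radford_rels r n q) a)" for a
    by (cases a) (simp_all add: radford_comult(2) radford_comult_gen_simps f2 \<phi> \<psi> \<theta>
        linear_map_add[OF algebra_hom_linear[OF f2(1)]])
qed

end

section \<open>Transfer from the algebra record to the Hopf algebra record\<close>

lemma radford_simps:
  "carrier (radford r n q) = carrier rad" "mult (radford r n q) = mult rad"
  "one (radford r n q) = one rad" "zero (radford r n q) = zero rad"
  "add (radford r n q) = add rad" "smult (radford r n q) = smult rad"
  "comult (radford r n q) = rad_\<Delta>"
  by (simp_all add: radford_def Let_def)

lemma symbol_monoid_radford: "symbol_monoid (radford r n q) m = symbol_monoid rad m"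
  by (simp add: symbol_monoid_def radford_simps)

lemma tensor_power_radford: "tensor_power (radford r n q) m = tensor_power rad m"
  by (simp add: tensor_power_def tensor_null_def multilinear_rels_def symbol_monoid_radford radford_simps
      del: symbol_monoid_simps)

lemma pure_tensor_radford: "pure_tensor (radford r n q) = pure_tensor rad"
  by (simp add: fun_eq_iff pure_tensor_def tensor_null_def multilinear_rels_def symbol_monoid_radford
      radford_simps del: symbol_monoid_simps)

lemma tensor_functional_radford: "tensor_functional (radford r n q) = tensor_functional rad"
  by (simp add: fun_eq_iff tensor_functional_def)

lemma linear_map_radford: "linear_map (radford r n q) B h = linear_map rad B h"
  by (simp add: linear_map_def radford_simps)

lemma algebra_hom_radford: "algebra_hom (radford r n q) B h = algebra_hom rad B h"
  by (simp add: algebra_hom_def linear_map_radford ring_hom_def radford_simps)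

lemma linear_subspace_radford: "linear_subspace (radford r n q) W = linear_subspace rad W"
  by (simp add: linear_subspace_def additive_subgroup_def subgroup_def m_inv_def radford_simps)

lemma pow_radford: "a [^]\<^bsub>radford r n q\<^esub> (m::nat) = a [^]\<^bsub>rad\<^esub> m"
  by (simp add: nat_pow_def radford_simps)

lemma k_algebra_radford: "k_algebra (radford r n q)"
  by (rule k_algebra_image[OF k_algebra_presented, where \<pi> = "\<lambda>a. a"]) (simp_all add: radford_simps)

text \<open>Collects the preceding results as an instance of the abstract setting; r \<ge> 2
  supplies 2n \<le> rn.\<close>

lemma radford_like_radford:
  assumes r: "r \<ge> 2" and n: "n \<ge> 1" and q: "primitive_root_of_unity (r * n) q"
  shows "radford_like (radford r n q) rad_g rad_x (r * n) n q radford_character"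
  by (rule radford_like.intro)
    (use r q radford_character[OF n] radford_comult[OF n q] radford_character_comult[OF n q] radford_relations
      radford_span gen_class_closed[of "radford_rels r n q"]
      in \<open>simp_all add: k_algebra_radford tensor_power_radford pure_tensor_radford tensor_functional_radford
        linear_map_radford algebra_hom_radford linear_subspace_radford pow_radford radford_simps
        algebra_hom_linear radford_comult_gen_simps\<close>)

end

theorem theorem4p15:
  fixes r n :: nat and q :: "'k::field"
    and R \<chi> :: "((radford_gen list \<Rightarrow>\<^sub>0 'k) set list \<Rightarrow>\<^sub>0 'k) set"
  assumes "r \<ge> 2" and "n \<ge> 1"
    and "CHAR('k) \<noteq> 2"
    and "primitive_root_of_unity (r * n) q"
    and "quasitriangular_structure (radford r n q) R"
    and "infinitesimal_R_matrix (radford r n q) R \<chi>"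
  shows "\<chi> = \<zero>\<^bsub>tensor_power (radford r n q) 2\<^esub>"
proof (rule radford_like.infinitesimal_zero[OF radford_like_radford[OF assms(1,2,4)] _ assms(6)])
  show "R \<in> Units (tensor_power (radford r n q) 2)"
    using assms(5) by (simp add: quasitriangular_structure_def)
qed

end
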